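(* Let $K/\mathbb Q$ be a cubic field, let $p\ge5$ be a prime inert and unramified in $K$, and let $\eta\in\mathcal O_K^\times$ with $\operatorname{Norm}_{K/\mathbb Q}(\eta)=1$. Let $P$ be the order of $\bar\eta$ in $(\mathcal O_K/p\mathcal O_K)^\times$ and $\omega_p=\frac{\eta^P-1}{p}\bmod p\in\mathcal O_K/p\mathcal O_K\simeq\mathbb F_{p^3}$. Then $\omega_p\in\mathbb F_p\iff\omega_p=0\iff\eta^P\equiv1\pmod{p^2}$. Consequently $1,\omega_p,\omega_p^2$ fails to be an $\mathbb F_p$-basis of $\mathbb F_{p^3}$ if and only if $\eta^P\equiv1\pmod{p^2}$. *)

theory Defs
  imports
    "HOL-Computational_Algebra.Polynomial"
    "HOL-Computational_Algebra.Primes"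
    "HOL-Algebra.Algebraic_Closure_Type"
    "HOL-Algebra.Embedded_Algebras"
    "HOL-Algebra.Ideal_Product"
    "HOL-Algebra.Multiplicative_Group"
    "Jordan_Normal_Form.Determinant"
begin

text \<open>
  A number field is a type \<open>'k\<close> of class \<open>field_char_0\<close> which has finite dimension over \<open>\<rat>\<close>.
\<close>

definition rat_scale :: "rat \<Rightarrow> 'k :: field_char_0 \<Rightarrow> 'k" where
  "rat_scale q x = of_rat q * x"

global_interpretation rat_vs: vector_space "rat_scale :: rat \<Rightarrow> 'k :: field_char_0 \<Rightarrow> 'k"
  by unfold_locales (simp_all add: rat_scale_def of_rat_add of_rat_mult algebra_simps)

text \<open>
  \<open>rat_vs.dim\<close> is \<open>0\<close> for infinite-dimensional spaces, so the equation includes finiteness.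
\<close>

definition cubic_field :: "'k :: field_char_0 itself \<Rightarrow> bool" where
  "cubic_field _ \<longleftrightarrow> rat_vs.dim (UNIV :: 'k set) = 3"

definition is_rat_basis :: "'k :: field_char_0 list \<Rightarrow> bool" where
  "is_rat_basis bs \<longleftrightarrow>
     distinct bs \<and> rat_vs.independent (set bs) \<and> rat_vs.span (set bs) = UNIV"

text \<open>
  Column \<open>j\<close> holds the coordinates of \<open>x * bs ! j\<close>, so this is the matrix of the \<open>\<rat>\<close>-linear map
  \<open>y \<mapsto> x * y\<close>. Its determinant does not depend on the basis.
\<close>

definition mult_matrix :: "'k :: field_char_0 list \<Rightarrow> 'k \<Rightarrow> rat mat" where
  "mult_matrix bs x =
     mat (length bs) (length bs)
       (\<lambda>(i, j). rat_vs.representation (set bs) (x * bs ! j) (bs ! i))"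

definition field_norm :: "'k :: field_char_0 \<Rightarrow> rat" where
  "field_norm x = det (mult_matrix (SOME bs. is_rat_basis bs) x)"

definition ring_of_integers :: "'k :: field_char_0 ring" (\<open>\<O>\<close>) where
  "\<O> = ring_of_type_algebra \<lparr> carrier := {x. algebraic_int x} \<rparr>"

definition inert :: "'k :: field_char_0 itself \<Rightarrow> nat \<Rightarrow> bool" where
  "inert _ p \<longleftrightarrow> primeideal (PIdl\<^bsub>\<O>\<^esub> (of_nat p :: 'k)) \<O>"

text \<open>
  No prime ideal above \<open>p\<close> has ramification index at least \<open>2\<close>. Residue fields are finite, so
  separability of the residue extensions is automatic.
\<close>

definition unramified :: "'k :: field_char_0 itself \<Rightarrow> nat \<Rightarrow> bool" where
  "unramified _ p \<longleftrightarrow>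
     (\<forall>Q. primeideal Q (\<O> :: 'k ring) \<longrightarrow> \<not> PIdl\<^bsub>\<O>\<^esub> (of_nat p :: 'k) \<subseteq> ideal_prod \<O> Q Q)"

definition residue_ring_at :: "'k :: field_char_0 itself \<Rightarrow> nat \<Rightarrow> 'k set ring" where
  "residue_ring_at _ p = \<O> Quot (PIdl\<^bsub>\<O>\<^esub> (of_nat p))"

definition reduce_mod :: "nat \<Rightarrow> 'k :: field_char_0 \<Rightarrow> 'k set" where
  "reduce_mod p x = PIdl\<^bsub>\<O>\<^esub> (of_nat p) +>\<^bsub>\<O>\<^esub> x"

definition unit_order :: "nat \<Rightarrow> 'k :: field_char_0 \<Rightarrow> nat" where
  "unit_order p \<eta> = group.ord (units_of (residue_ring_at TYPE('k) p)) (reduce_mod p \<eta>)"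

text \<open>
  The division takes place in the field; the quotient is an algebraic integer because
  \<open>\<eta> ^ unit_order p \<eta>\<close> reduces to \<open>1\<close>.
\<close>

definition omega :: "nat \<Rightarrow> 'k :: field_char_0 \<Rightarrow> 'k set" where
  "omega p \<eta> = reduce_mod p ((\<eta> ^ unit_order p \<eta> - 1) / of_nat p)"

text \<open>
  The image of \<open>\<int>\<close> in a ring; in a ring of prime characteristic \<open>p\<close> this is the copy of
  \<open>\<F>\<^sub>p\<close> inside it.
\<close>

definition prime_subring :: "('a, 'b) ring_scheme \<Rightarrow> 'a set" where
  "prime_subring R = range (\<lambda>n :: int. add_pow R n \<one>\<^bsub>R\<^esub>)"

definition is_basis_over :: "('a, 'b) ring_scheme \<Rightarrow> 'a set \<Rightarrow> 'a list \<Rightarrow> bool" where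
  "is_basis_over R F vs \<longleftrightarrow>
     set vs \<subseteq> carrier R \<and> ring.independent R F vs \<and> ring.Span R F vs = carrier R"

end

theory Submission
  imports
    Defs
    "Jordan_Normal_Form.Char_Poly"
    "HOL-Algebra.Finite_Extensions"
    "HOL-Number_Theory.Cong"
begin

text \<open>
  The ring of integers \<open>\<O>\<close> of \<open>K\<close> has a \<open>\<int>\<close>-basis: the norm is integral on \<open>\<O>\<close> because the matrices of
  the powers of an integral element have bounded denominators, hence so is
  \<open>2 Tr x = N (x + 1) + N (x - 1) - 2 N x\<close>, and an integral triple with minimal nonzero trace
  determinant generates \<open>\<O>\<close>. Therefore \<open>\<O> / p\<O>\<close> is a domain with \<open>p\<^sup>3\<close> elements, that is, a field.

  Write \<open>\<eta>\<^sup>P = 1 + p w\<close>. If \<open>w\<close> reduces to \<open>a \<in> \<F>\<^sub>p\<close>, then \<open>\<eta>\<^sup>P = 1 + p a + p\<^sup>2 \<beta>\<close> with \<open>\<beta>\<close> integral, and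
  taking norms gives \<open>1 \<equiv> 1 + 3 p a\<close> modulo \<open>p\<^sup>2\<close>; as \<open>p \<noteq> 3\<close>, \<open>p\<close> divides \<open>a\<close>. The extension of \<open>\<F>\<^sub>p\<close> has
  prime degree \<open>3\<close>, so every element outside \<open>\<F>\<^sub>p\<close> generates it.
\<close>

section \<open>Algebraic integers form a ring\<close>

text \<open>The vector \<open>v\<close> is an eigenvector of the integer matrix \<open>A\<close>
  with eigenvalue \<open>z\<close>, so \<open>z\<close> is a root of the characteristic polynomial
  of \<open>A\<close>, which is monic with integer coefficients.\<close>

lemma algebraic_int_if_int_matrix:
  fixes z :: "'k :: field_char_0" and v :: "nat \<Rightarrow> 'k" and A :: "nat \<Rightarrow> nat \<Rightarrow> int"
  assumes eq: "\<And>i. i < n \<Longrightarrow> z * v i = (\<Sum>j<n. of_int (A i j) * v j)"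
    and nz: "k < n" "v k \<noteq> 0"
  shows "algebraic_int z"
proof -
  define B where "B = mat n n (\<lambda>(i, j). A i j)"
  have B: "B \<in> carrier_mat n n" by (simp add: B_def)
  define C where "C = map_mat (of_int :: int \<Rightarrow> 'k) B"
  have C: "C \<in> carrier_mat n n" using B by (simp add: C_def)
  have "C *\<^sub>v vec n v = z \<cdot>\<^sub>v vec n v"
    by (rule eq_vecI) (auto simp: C_def B_def scalar_prod_def eq atLeast0LessThan)
  moreover have "vec n v \<noteq> 0\<^sub>v n"
    using nz by (metis index_vec index_zero_vec(1))
  ultimately have "eigenvector C (vec n v) z"
    using C by (auto simp: eigenvector_def)
  then have "poly (char_poly C) z = 0"
    using eigenvalue_root_char_poly[OF C] by (auto simp: eigenvalue_def)
  also have "char_poly C = map_poly of_int (char_poly B)"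
    unfolding C_def by (rule of_int_hom.char_poly_hom[OF B])
  finally show ?thesis
    using degree_monic_char_poly[OF B] by (auto simp: algebraic_int_altdef_ipoly)
qed

text \<open>Used for finite \<open>S\<close>, where it is the subgroup generated by
  \<open>S\<close>; for infinite \<open>S\<close> the sum defaults to 0 and the set collapses to
  {0}.\<close>

definition int_span :: "'k :: field_char_0 set \<Rightarrow> 'k set" where
  "int_span S = {\<Sum>s\<in>S. of_int (c s) * s | c. True}"

lemma int_span_zero: "0 \<in> int_span S"
  unfolding int_span_def by (auto intro!: exI[of _ "\<lambda>_. 0"])

lemma int_span_base:
  assumes "finite S" "s \<in> S"
  shows "s \<in> int_span S"
proof -
  have "(\<Sum>t\<in>S. of_int (if t = s then 1 else 0) * t) = (\<Sum>t\<in>S. if t = s then t else 0)"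
    by (rule sum.cong) auto
  also have "\<dots> = s"
    using assms by simp
  finally show ?thesis
    unfolding int_span_def by (auto intro!: exI[of _ "\<lambda>t. if t = s then 1 else 0"])
qed

lemma int_span_add: "x \<in> int_span S \<Longrightarrow> y \<in> int_span S \<Longrightarrow> x + y \<in> int_span S"
  unfolding int_span_def
proof clarify
  fix c d :: "'a \<Rightarrow> int"
  show "\<exists>e. (\<Sum>s\<in>S. of_int (c s) * s) + (\<Sum>s\<in>S. of_int (d s) * s) = (\<Sum>s\<in>S. of_int (e s) * s) \<and> True"
    by (rule exI[of _ "\<lambda>s. c s + d s"]) (simp add: sum.distrib algebra_simps)
qed

lemma int_span_scale: "x \<in> int_span S \<Longrightarrow> of_int m * x \<in> int_span S"
  unfolding int_span_def
proof clarify
  fix c :: "'a \<Rightarrow> int"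
  show "\<exists>e. of_int m * (\<Sum>s\<in>S. of_int (c s) * s) = (\<Sum>s\<in>S. of_int (e s) * s) \<and> True"
    by (rule exI[of _ "\<lambda>s. m * c s"]) (simp add: sum_distrib_left algebra_simps)
qed

lemma int_span_sum: "(\<And>i. i \<in> I \<Longrightarrow> f i \<in> int_span S) \<Longrightarrow> sum f I \<in> int_span S"
  by (induction I rule: infinite_finite_induct) (auto intro: int_span_zero int_span_add)

lemma int_span_mult_stable:
  assumes "\<And>s. s \<in> S \<Longrightarrow> z * s \<in> int_span S" and "x \<in> int_span S"
  shows "z * x \<in> int_span S"
proof -
  obtain c where x: "x = (\<Sum>s\<in>S. of_int (c s) * s)"
    using assms(2) by (auto simp: int_span_def)
  have "z * x = (\<Sum>s\<in>S. of_int (c s) * (z * s))"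
    by (simp add: x sum_distrib_left algebra_simps)
  then show ?thesis
    by (auto intro!: int_span_sum int_span_scale assms)
qed

text \<open>The determinant trick: an enumeration of \<open>S\<close> turns stability of its integer
  span under \<open>z\<close> into an integer matrix with eigenvalue \<open>z\<close>.\<close>

lemma algebraic_int_if_int_span_stable:
  fixes z :: "'k :: field_char_0"
  assumes "finite S" and stable: "\<And>s. s \<in> S \<Longrightarrow> z * s \<in> int_span S"
    and s: "s \<in> S" "s \<noteq> 0"
  shows "algebraic_int z"
proof -
  obtain v where v: "bij_betw v {..<card S} S"
    using \<open>finite S\<close> ex_bij_betw_nat_finite[of S] by (auto simp: atLeast0LessThan)
  have "\<exists>c. z * s = (\<Sum>j<card S. of_int (c j) * v j)" if s: "s \<in> S" for s
  proof -
    obtain c where "z * s = (\<Sum>t\<in>S. of_int (c t) * t)"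
      using stable[OF s] by (auto simp: int_span_def)
    also have "\<dots> = (\<Sum>j<card S. of_int (c (v j)) * v j)"
      by (rule sum.reindex_bij_betw[OF v, symmetric])
    finally show ?thesis by (intro exI[of _ "\<lambda>j. c (v j)"])
  qed
  then obtain A where "\<And>s. s \<in> S \<Longrightarrow> z * s = (\<Sum>j<card S. of_int (A s j) * v j)"
    by metis
  then have eq: "z * v i = (\<Sum>j<card S. of_int (A (v i) j) * v j)" if "i < card S" for i
    using v that by (auto simp: bij_betw_def)
  obtain k where "k < card S" "v k = s"
    using v s by (metis bij_betw_def imageE lessThan_iff)
  then show ?thesis
    using eq s by (intro algebraic_int_if_int_matrix[of "card S" z v "\<lambda>i. A (v i)" k]) auto
qed

lemma algebraic_int_power_recurrence:
  fixes x :: "'k :: field_char_0"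
  assumes "algebraic_int x"
  obtains n c where "n > 0" "x ^ n = (\<Sum>i<n. of_int (c i) * x ^ i)"
proof -
  obtain f where f: "poly (map_poly of_int f) x = 0" "lead_coeff f = 1"
    using assms by (auto simp: algebraic_int_altdef_ipoly)
  define n where "n = degree f"
  have deg: "degree (map_poly (of_int :: int \<Rightarrow> 'k) f) = n"
    by (simp add: n_def)
  have "0 = (\<Sum>i\<le>n. of_int (coeff f i) * x ^ i)"
    using f(1) by (simp add: poly_altdef deg del: of_int_hom.degree_map_poly_hom)
  also have "\<dots> = x ^ n + (\<Sum>i<n. of_int (coeff f i) * x ^ i)"
    using f(2) by (simp add: lessThan_Suc_atMost[symmetric] n_def)
  finally have eq: "x ^ n = (\<Sum>i<n. of_int (- coeff f i) * x ^ i)"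
    by (simp add: sum_negf eq_neg_iff_add_eq_0)
  \<comment> \<open>For n = 0 the recurrence would read 1 = 0.\<close>
  moreover have "n > 0"
    using eq by (cases n) auto
  ultimately show ?thesis by (rule that[rotated])
qed

text \<open>Multiplication by x raises the exponent of x by one. The result is again one of the
  listed products, except at the top exponent n - 1, where the recurrence brings it back into the
  span.\<close>

lemma int_span_power_products:
  fixes x y :: "'k :: field_char_0"
  assumes "n > 0" and rec: "x ^ n = (\<Sum>i<n. of_int (c i) * x ^ i)"
    and s: "s \<in> (\<lambda>(i, j). x ^ i * y ^ j) ` ({..<n} \<times> {..<m})"
  shows "x * s \<in> int_span ((\<lambda>(i, j). x ^ i * y ^ j) ` ({..<n} \<times> {..<m}))" (is "_ \<in> int_span ?S")
proof -
  obtain i j where ij: "i < n" "j < m" "s = x ^ i * y ^ j" using s by auto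
  have base: "x ^ k * y ^ j \<in> int_span ?S" if "k < n" for k
    using that ij by (intro int_span_base) force+
  show ?thesis
  proof (cases "Suc i = n")
    case True
    then have "x * s = x ^ n * y ^ j"
      by (auto simp: ij(3))
    also have "\<dots> = (\<Sum>i<n. of_int (c i) * (x ^ i * y ^ j))"
      by (simp add: rec sum_distrib_right mult.assoc)
    finally show ?thesis
      by (auto intro!: int_span_sum int_span_scale base)
  next
    case False
    then show ?thesis
      using base[of "Suc i"] ij by (simp add: algebra_simps)
  qed
qed

text \<open>The finitely many products x^i y^j span a group stable under both x and y, hence under x
  + y and x y.\<close>

lemma algebraic_int_add_mult:
  fixes x y :: "'k :: field_char_0"
  assumes "algebraic_int x" "algebraic_int y"
  shows algebraic_int_add: "algebraic_int (x + y)"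
    and algebraic_int_mult: "algebraic_int (x * y)"
proof -
  obtain n c where n: "n > 0" "x ^ n = (\<Sum>i<n. of_int (c i) * x ^ i)"
    using algebraic_int_power_recurrence[OF assms(1)] .
  obtain m d where m: "m > 0" "y ^ m = (\<Sum>i<m. of_int (d i) * y ^ i)"
    using algebraic_int_power_recurrence[OF assms(2)] .
  define S where "S = (\<lambda>(i, j). x ^ i * y ^ j) ` ({..<n} \<times> {..<m})"
  \<comment> \<open>The same set with x and y exchanged, so that the lemma on power products also
    covers multiplication by y.\<close>
  have S': "S = (\<lambda>(i, j). y ^ i * x ^ j) ` ({..<m} \<times> {..<n})"
    unfolding S_def by (auto simp: image_iff mult.commute intro!: bexI)
  have x: "x * s \<in> int_span S" if "s \<in> S" for s
    unfolding S_def using that by (intro int_span_power_products[OF n]) (simp add: S_def)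
  have y: "y * s \<in> int_span S" if "s \<in> S" for s
    unfolding S' using that by (intro int_span_power_products[OF m]) (simp add: S')
  have S: "finite S" "1 \<in> S"
    using n(1) m(1) by (force simp: S_def intro!: image_eqI[of _ _ "(0,0)"])+
  have "(x + y) * s \<in> int_span S" if "s \<in> S" for s
    using int_span_add[OF x y] that by (simp add: algebra_simps)
  then show "algebraic_int (x + y)"
    using S by (intro algebraic_int_if_int_span_stable[of S _ 1]) auto
  have "(x * y) * s \<in> int_span S" if "s \<in> S" for s
    using int_span_mult_stable[OF x y] that by (simp add: mult.assoc)
  then show "algebraic_int (x * y)"
    using S by (intro algebraic_int_if_int_span_stable[of S _ 1]) auto
qed

section \<open>Further closure properties of the algebraic integers\<close>

lemma algebraic_int_diff:
  "algebraic_int (x :: 'k :: field_char_0) \<Longrightarrow> algebraic_int y \<Longrightarrow> algebraic_int (x - y)"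
  using algebraic_int_add[of x "- y"] by auto

lemma algebraic_int_power:
  "algebraic_int (x :: 'k :: field_char_0) \<Longrightarrow> algebraic_int (x ^ n)"
  by (induction n) (auto intro: algebraic_int_mult int_imp_algebraic_int)

lemma algebraic_int_of_int: "algebraic_int (of_int m :: 'k :: field_char_0)"
  by (rule int_imp_algebraic_int) simp

lemma algebraic_int_sum:
  "(\<And>i. i \<in> I \<Longrightarrow> algebraic_int (f i :: 'k :: field_char_0)) \<Longrightarrow> algebraic_int (sum f I)"
  by (induction I rule: infinite_finite_induct) (auto intro: algebraic_int_add)

section \<open>Coordinates and norms\<close>

text \<open>Coordinates are indexed by position in the list instead of by basis vector, so that they
  can serve as matrix entries.\<close>

definition coord :: "'k :: field_char_0 list \<Rightarrow> 'k \<Rightarrow> nat \<Rightarrow> rat" where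
  "coord bs x i = rat_vs.representation (set bs) x (bs ! i)"

lemma coord_expand:
  fixes bs :: "'k :: field_char_0 list"
  assumes "is_rat_basis bs"
  shows "(\<Sum>i<length bs. of_rat (coord bs x i) * bs ! i) = x"
proof -
  have bs: "distinct bs" "rat_vs.independent (set bs)" "x \<in> rat_vs.span (set bs)"
    using assms by (auto simp: is_rat_basis_def)
  have "(\<Sum>i<length bs. of_rat (coord bs x i) * bs ! i)
      = (\<Sum>b\<in>set bs. of_rat (rat_vs.representation (set bs) x b) * b)"
    unfolding coord_def
    by (rule sum.reindex_bij_betw) (use bs in \<open>auto intro: bij_betw_nth\<close>)
  also have "\<dots> = x"
    using rat_vs.sum_representation_eq[OF bs(2,3), of "set bs"] by (simp add: rat_scale_def)
  finally show ?thesis .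
qed

lemma coord_add:
  "is_rat_basis bs \<Longrightarrow> coord bs (x + y) i = coord bs x i + coord bs y i"
  by (simp add: is_rat_basis_def coord_def rat_vs.representation_add)

lemma coord_of_rat_mult:
  "is_rat_basis bs \<Longrightarrow> coord bs (of_rat q * x) i = q * coord bs x i"
  using rat_vs.representation_scale[of "set bs" x q]
  by (simp add: is_rat_basis_def coord_def rat_scale_def)

lemma coord_of_int_mult:
  "is_rat_basis bs \<Longrightarrow> coord bs (of_int m * x) i = of_int m * coord bs x i"
  using coord_of_rat_mult[of bs "of_int m"] by simp

lemma coord_zero: "is_rat_basis bs \<Longrightarrow> coord bs 0 i = 0"
  by (simp add: coord_def rat_vs.representation_zero)

lemma coord_sum:
  "is_rat_basis bs \<Longrightarrow> coord bs (sum f I) i = (\<Sum>j\<in>I. coord bs (f j) i)"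
  by (induction I rule: infinite_finite_induct) (auto simp: coord_zero coord_add)

lemma coord_basis:
  "is_rat_basis bs \<Longrightarrow> i < length bs \<Longrightarrow> j < length bs \<Longrightarrow>
     coord bs (bs ! j) i = (if i = j then 1 else 0)"
  by (auto simp: is_rat_basis_def coord_def rat_vs.representation_basis nth_eq_iff_index_eq)

lemma coord_unique:
  assumes bs: "is_rat_basis bs" and i: "i < length bs"
  shows "coord bs (\<Sum>j<length bs. of_rat (q j) * bs ! j) i = q i"
proof -
  have "coord bs (\<Sum>j<length bs. of_rat (q j) * bs ! j) i
      = (\<Sum>j<length bs. if i = j then q j else 0)"
    unfolding coord_sum[OF bs] by (rule sum.cong) (auto simp: coord_of_rat_mult coord_basis bs i)
  then show ?thesis using i by simp
qed

lemma is_rat_basis_length: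
  "is_rat_basis (bs :: 'k :: field_char_0 list) \<Longrightarrow> length bs = rat_vs.dim (UNIV :: 'k set)"
  by (metis distinct_card is_rat_basis_def rat_vs.dim_eq_card rat_vs.span_UNIV)

lemma cubic_field_basis:
  assumes "cubic_field TYPE('k :: field_char_0)"
  obtains bs :: "'k :: field_char_0 list" where "is_rat_basis bs"
proof -
  obtain B :: "'k set" where B: "rat_vs.independent B" "rat_vs.span B = UNIV" "card B = 3"
    using rat_vs.basis_exists[of "UNIV :: 'k set"] assms
    by (metis UNIV_I cubic_field_def subsetI subset_antisym)
  then have "finite B" using card.infinite by fastforce
  then obtain bs where "set bs = B" "distinct bs" using finite_distinct_list by blast
  with B show ?thesis by (intro that[of bs]) (simp add: is_rat_basis_def)
qed

text \<open>The known basis \<open>bs\<close> fixes the dimension, and as many independent vectors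
  must span. Independence is stated by positions, so it also excludes repetitions in
  \<open>xs\<close>.\<close>

lemma is_rat_basis_if_independent:
  fixes bs xs :: "'k :: field_char_0 list"
  assumes bs: "is_rat_basis bs" and len: "length xs = length bs"
    and indep: "\<And>q i. (\<Sum>i<length xs. of_rat (q i) * xs ! i) = 0 \<Longrightarrow> i < length xs \<Longrightarrow> q i = 0"
  shows "is_rat_basis xs"
proof -
  have dist: "distinct xs"
  proof (rule ccontr)
    assume "\<not> distinct xs"
    then obtain i j where ij: "i < length xs" "j < length xs" "i \<noteq> j" "xs ! i = xs ! j"
      by (auto simp: distinct_conv_nth)
    \<comment> \<open>The relation \<open>xs ! i - xs ! j = 0\<close> is nontrivial because the
      positions differ.\<close>
    define q :: "nat \<Rightarrow> rat" where "q k = (if k = i then 1 else 0) - (if k = j then 1 else 0)" for k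
    have "(\<Sum>k<length xs. of_rat (q k) * xs ! k)
        = (\<Sum>k<length xs. if k = i then xs ! k else 0) - (\<Sum>k<length xs. if k = j then xs ! k else 0)"
      unfolding sum_subtractf[symmetric] by (rule sum.cong) (auto simp: q_def of_rat_minus)
    also have "\<dots> = 0" using ij by simp
    finally have "q i = 0" using indep[of q i] ij by simp
    then show False using ij by (simp add: q_def)
  qed
  have ind: "rat_vs.independent (set xs)"
  proof (rule ccontr)
    assume "\<not> rat_vs.independent (set xs)"
    then obtain u v where u: "v \<in> set xs" "u v \<noteq> 0" "(\<Sum>v\<in>set xs. rat_scale (u v) v) = 0"
      using rat_vs.dependent_finite[of "set xs"] by auto
    obtain i where i: "i < length xs" "xs ! i = v" using u by (auto simp: in_set_conv_nth)
    have "(\<Sum>i<length xs. of_rat (u (xs ! i)) * xs ! i) = (\<Sum>v\<in>set xs. of_rat (u v) * v)"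
      by (rule sum.reindex_bij_betw) (use dist in \<open>auto intro: bij_betw_nth\<close>)
    then have "u (xs ! i) = 0"
      using indep[of "\<lambda>i. u (xs ! i)" i] u i by (simp add: rat_scale_def)
    then show False using u i by simp
  qed
  have "y \<in> rat_vs.span (set xs)" for y
  proof (rule ccontr)
    assume y: "y \<notin> rat_vs.span (set xs)"
    \<comment> \<open>A vector outside the span would give one independent vector more than
      \<open>bs\<close> has elements.\<close>
    then have "rat_vs.independent (insert y (set xs))"
      using ind by (simp add: rat_vs.independent_insert)
    then have "card (insert y (set xs)) \<le> card (set bs)"
      using bs rat_vs.independent_span_bound[of "set bs" "insert y (set xs)"]
      by (auto simp: is_rat_basis_def)
    moreover have "y \<notin> set xs" using y rat_vs.span_base by blast
    ultimately show False
      using bs dist len by (simp add: is_rat_basis_def distinct_card)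
  qed
  then show ?thesis using dist ind by (auto simp: is_rat_basis_def)
qed

section \<open>Multiplication matrices and the independence of the norm from the basis\<close>

lemma mult_matrix_carrier: "mult_matrix bs x \<in> carrier_mat (length bs) (length bs)"
  by (simp add: mult_matrix_def)

lemma mult_matrix_dim [simp]:
  "dim_row (mult_matrix bs x) = length bs" "dim_col (mult_matrix bs x) = length bs"
  by (simp_all add: mult_matrix_def)

lemma mult_matrix_index:
  "i < length bs \<Longrightarrow> j < length bs \<Longrightarrow> mult_matrix bs x $$ (i, j) = coord bs (x * bs ! j) i"
  by (simp add: mult_matrix_def coord_def)

text \<open>With \<open>bs = bs' = bs''\<close> this is multiplicativity of \<open>mult_matrix\<close>; with \<open>x = 1\<close> or \<open>y = 1\<close> it
  relates the matrices of one map in two bases.\<close>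

lemma coord_mult_basis_compose:
  assumes bs: "is_rat_basis bs" and bs': "is_rat_basis bs'"
    and len: "length bs = length bs'"
  shows "mat (length bs) (length bs) (\<lambda>(i, j). coord bs (x * bs' ! j) i) *
           mat (length bs) (length bs) (\<lambda>(i, j). coord bs' (y * bs'' ! j) i)
       = mat (length bs) (length bs) (\<lambda>(i, j). coord bs (x * y * bs'' ! j) i)"
    (is "?A * ?B = ?C")
proof (rule eq_matI)
  fix i j assume "i < dim_row ?C" "j < dim_col ?C"
  then have ij: "i < length bs" "j < length bs" by auto
  have "(?A * ?B) $$ (i, j) = (\<Sum>k<length bs. coord bs (x * bs' ! k) i * coord bs' (y * bs'' ! j) k)"
    using ij by (simp add: scalar_prod_def atLeast0LessThan)
  also have "\<dots> = (\<Sum>k<length bs. coord bs (of_rat (coord bs' (y * bs'' ! j) k) * (x * bs' ! k)) i)"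
    unfolding coord_of_rat_mult[OF bs] by (simp add: mult.commute)
  also have "\<dots> = coord bs (x * (\<Sum>k<length bs. of_rat (coord bs' (y * bs'' ! j) k) * bs' ! k)) i"
    by (simp add: coord_sum[OF bs, symmetric] sum_distrib_left mult.left_commute)
  also have "\<dots> = coord bs (x * (y * bs'' ! j)) i"
    using coord_expand[OF bs'] by (simp add: len)
  finally show "(?A * ?B) $$ (i, j) = ?C $$ (i, j)"
    using ij by (simp add: mult.assoc)
qed auto

lemma mult_matrix_eq: "mult_matrix bs x = mat (length bs) (length bs) (\<lambda>(i, j). coord bs (x * bs ! j) i)"
  by (simp add: mult_matrix_def coord_def)

lemma mult_matrix_mult:
  "is_rat_basis bs \<Longrightarrow> mult_matrix bs (x * y) = mult_matrix bs x * mult_matrix bs y"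
  by (simp add: mult_matrix_eq coord_mult_basis_compose)

lemma mult_matrix_one: "is_rat_basis bs \<Longrightarrow> mult_matrix bs 1 = 1\<^sub>m (length bs)"
  by (rule eq_matI) (auto simp: mult_matrix_index coord_basis)

lemma det_mult_matrix_mult:
  "is_rat_basis bs \<Longrightarrow>
     det (mult_matrix bs (x * y)) = det (mult_matrix bs x) * det (mult_matrix bs y)"
  by (simp add: mult_matrix_mult det_mult[OF mult_matrix_carrier mult_matrix_carrier])

lemma det_mult_matrix_power:
  "is_rat_basis bs \<Longrightarrow> det (mult_matrix bs (x ^ n)) = det (mult_matrix bs x) ^ n"
  by (induction n) (simp_all add: mult_matrix_one det_mult_matrix_mult)

text \<open>The change of basis matrix \<open>T\<close> is invertible and intertwines the two
  multiplication matrices, so these have the same determinant.\<close>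

lemma det_mult_matrix_basis_indep:
  fixes bs bs' :: "'k :: field_char_0 list"
  assumes bs: "is_rat_basis bs" and bs': "is_rat_basis bs'"
  shows "det (mult_matrix bs x) = det (mult_matrix bs' x)"
proof -
  define n where "n = length bs"
  have len: "length bs = n" "length bs' = n"
    using is_rat_basis_length[OF bs] is_rat_basis_length[OF bs'] by (simp_all add: n_def)
  define T where "T = mat n n (\<lambda>(i, j). coord bs (1 * bs' ! j) i)"
  define S where "S = mat n n (\<lambda>(i, j). coord bs' (1 * bs ! j) i)"
  have carr: "T \<in> carrier_mat n n" "S \<in> carrier_mat n n"
    "mult_matrix bs x \<in> carrier_mat n n" "mult_matrix bs' x \<in> carrier_mat n n"
    using mult_matrix_carrier[of bs] mult_matrix_carrier[of bs'] by (auto simp: T_def S_def len)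
  have "T * S = mult_matrix bs 1"
    using coord_mult_basis_compose[OF bs bs', of 1 1 bs] by (simp add: T_def S_def mult_matrix_eq len)
  then have "det T * det S = 1"
    using det_mult[OF carr(1,2)] by (simp add: mult_matrix_one bs)
  then have "det T \<noteq> 0" by auto
  \<comment> \<open>Column j of either product holds the coordinates of \<open>x * bs' ! j\<close>
    with respect to \<open>bs\<close>.\<close>
  moreover have "mult_matrix bs x * T = T * mult_matrix bs' x"
    using coord_mult_basis_compose[OF bs bs, of x 1 bs'] coord_mult_basis_compose[OF bs bs', of 1 x bs']
    by (simp add: T_def mult_matrix_eq len)
  then have "det (mult_matrix bs x) * det T = det T * det (mult_matrix bs' x)"
    using det_mult[OF carr(3,1)] det_mult[OF carr(1,4)] by metis
  ultimately show ?thesis by simp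
qed

text \<open>Frees the norm from the basis picked by \<open>SOME\<close>: that choice is a basis
  because one exists, and every basis gives the same determinant.\<close>

lemma field_norm_eq:
  assumes "is_rat_basis bs"
  shows "field_norm x = det (mult_matrix bs x)"
proof -
  have "is_rat_basis (SOME bs :: 'a list. is_rat_basis bs)"
    using assms by (rule someI)
  then show ?thesis
    unfolding field_norm_def using assms by (rule det_mult_matrix_basis_indep)
qed

section \<open>An integral basis\<close>

lemma common_denominator:
  fixes q :: "'a \<Rightarrow> rat"
  assumes "finite I"
  shows "\<exists>d :: int. d > 0 \<and> (\<forall>i\<in>I. of_int d * q i \<in> \<int>)"
  using assms
proof (induction I)
  case empty
  show ?case by (intro exI[of _ 1]) auto
next
  case (insert a I)
  then obtain d :: int where d: "d > 0" "\<And>i. i \<in> I \<Longrightarrow> of_int d * q i \<in> \<int>" by blast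
  obtain u v where uv: "q a = of_int u / of_int v" "v > (0 :: int)"
    by (metis Fract_of_int_quotient quotient_of_denom_pos quotient_of_unique)
  have "of_int (d * v) * q i \<in> \<int>" if "i \<in> insert a I" for i
  proof (cases "i = a")
    case True
    then have "of_int (d * v) * q i = of_int (d * u)" using uv by simp
    then show ?thesis by (metis Ints_of_int)
  next
    case False
    then have "of_int v * (of_int d * q i) \<in> \<int>" using d that by auto
    then show ?thesis by (simp add: mult.assoc mult.left_commute)
  qed
  then show ?case using d uv by (intro exI[of _ "d * v"]) auto
qed

text \<open>In lowest terms q = a / b, every power of b divides the fixed number d, which forces b =
  1.\<close>

lemma rat_int_if_powers_bounded_denominator:
  fixes q :: rat and d :: int
  assumes d: "d > 0" and int: "\<And>k. of_int d * q ^ k \<in> \<int>"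
  shows "q \<in> \<int>"
proof -
  obtain a b where ab: "q = of_int a / of_int b" "b > (0 :: int)" "coprime a b"
    by (metis Fract_of_int_quotient quotient_of_coprime quotient_of_denom_pos quotient_of_unique)
  have dvd: "b ^ k dvd d" for k
  proof -
    obtain m where "of_int d * q ^ k = of_int m" using int[of k] by (auto elim: Ints_cases)
    then have "of_int (d * a ^ k) = (of_int (m * b ^ k) :: rat)"
      using ab by (simp add: power_divide field_simps)
    then have "d * a ^ k = m * b ^ k" using of_int_eq_iff by blast
    then have "b ^ k dvd d * a ^ k" by simp
    moreover have "coprime (b ^ k) (a ^ k)" using ab(3) by (simp add: coprime_commute)
    ultimately show ?thesis by (simp add: coprime_dvd_mult_left_iff)
  qed
  have "b = 1"
  proof (rule ccontr)
    assume "b \<noteq> 1"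
    then have "b \<ge> 2" using ab by simp
    \<comment> \<open>The exponent d itself already suffices, since 2^d > d.\<close>
    then have "b ^ nat d \<ge> 2 ^ nat d" by (intro power_mono) auto
    moreover have "(2 :: int) ^ nat d > int (nat d)"
      using of_nat_less_two_power by blast
    moreover have "b ^ nat d \<le> d" using dvd d by (intro zdvd_imp_le) auto
    ultimately show False using d by simp
  qed
  then show ?thesis using ab by simp
qed

lemma det_in_Ints:
  fixes A :: "'a :: comm_ring_1 mat"
  assumes A: "A \<in> carrier_mat n n" and "\<And>i j. i < n \<Longrightarrow> j < n \<Longrightarrow> A $$ (i, j) \<in> \<int>"
  shows "det A \<in> \<int>"
  unfolding det_def'[OF A]
proof (intro Ints_sum Ints_mult Ints_prod)
  fix p i assume "p \<in> {p. p permutes {0..<n}}" "i \<in> {0..<n}"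
  then show "A $$ (i, p i) \<in> \<int>"
    using assms(2)[of i "p i"] permutes_in_image[of p "{0..<n}" i] by auto
qed (auto simp: sign_def)

text \<open>One denominator d clears the matrices of all powers of x. Hence d^N clears all powers of
  the determinant, which is therefore an integer.\<close>

lemma det_mult_matrix_in_Ints:
  fixes x :: "'k :: field_char_0" and bs :: "'k list"
  assumes bs: "is_rat_basis bs" and x: "algebraic_int x"
  shows "det (mult_matrix bs x) \<in> \<int>"
proof -
  define N where "N = length bs"
  obtain n c where rec: "n > 0" "x ^ n = (\<Sum>i<n. of_int (c i) * x ^ i)"
    using algebraic_int_power_recurrence[OF x] .
  obtain d :: int where d: "d > 0"
    "\<And>k i j. k < n \<Longrightarrow> i < N \<Longrightarrow> j < N \<Longrightarrow> of_int d * coord bs (x ^ k * bs ! j) i \<in> \<int>"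
    using common_denominator[of "{..<n} \<times> {..<N} \<times> {..<N}" "\<lambda>(k, i, j). coord bs (x ^ k * bs ! j) i"]
    by auto
  have all: "of_int d * coord bs (x ^ k * bs ! j) i \<in> \<int>" if "i < N" "j < N" for k i j
  proof (induction k rule: less_induct)
    case (less k)
    show ?case
    proof (cases "k < n")
      case True
      then show ?thesis using d that by auto
    next
      case False
      \<comment> \<open>The recurrence expresses x^k through the exponents k - n + l < k with
        integer coefficients, so the denominator chosen for exponents below n persists.\<close>
      then have "x ^ k = x ^ (k - n) * x ^ n" by (simp flip: power_add)
      also have "\<dots> = (\<Sum>l<n. of_int (c l) * x ^ (k - n + l))"
        by (simp add: rec(2) sum_distrib_left power_add mult.left_commute)
      finally have "x ^ k * bs ! j = (\<Sum>l<n. of_int (c l) * (x ^ (k - n + l) * bs ! j))"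
        by (simp add: sum_distrib_right mult.assoc)
      then have "of_int d * coord bs (x ^ k * bs ! j) i
          = (\<Sum>l<n. of_int (c l) * (of_int d * coord bs (x ^ (k - n + l) * bs ! j) i))"
        by (simp add: coord_sum coord_of_int_mult bs sum_distrib_left mult.left_commute)
      also have "\<dots> \<in> \<int>"
        using False by (intro Ints_sum Ints_mult[OF Ints_of_int] less) auto
      finally show ?thesis .
    qed
  qed
  have "of_int (d ^ N) * det (mult_matrix bs x) ^ k \<in> \<int>" for k
  proof -
    \<comment> \<open>Scaling an N by N matrix by d multiplies its determinant by d^N, and the
      matrix of x^k has determinant \<open>det (mult_matrix bs x) ^ k\<close>.\<close>
    have "of_int (d ^ N) * det (mult_matrix bs x) ^ k
        = det (of_int d \<cdot>\<^sub>m mult_matrix bs (x ^ k))"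
      by (simp add: det_mult_matrix_power[OF bs] N_def)
    also have "\<dots> \<in> \<int>"
      by (rule det_in_Ints[of _ N]) (auto simp: N_def mult_matrix_index all[unfolded N_def] mult_matrix_carrier)
    finally show ?thesis .
  qed
  with zero_less_power[OF d(1)] show ?thesis
    by (rule rat_int_if_powers_bounded_denominator)
qed

lemma det_3:
  fixes A :: "'a :: comm_ring_1 mat"
  assumes A: "A \<in> carrier_mat 3 3"
  shows "det A =
      A $$ (0, 0) * (A $$ (1, 1) * A $$ (2, 2) - A $$ (1, 2) * A $$ (2, 1))
    - A $$ (0, 1) * (A $$ (1, 0) * A $$ (2, 2) - A $$ (1, 2) * A $$ (2, 0))
    + A $$ (0, 2) * (A $$ (1, 0) * A $$ (2, 1) - A $$ (1, 1) * A $$ (2, 0))"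
proof -
  have det2: "det B = B $$ (0, 0) * B $$ (1, 1) - B $$ (0, 1) * B $$ (1, 0)"
    if B: "B \<in> carrier_mat 2 2" for B :: "'a mat"
    using B
    by (simp add: laplace_expansion_row[OF B, of 0] cofactor_def numeral_2_eq_2 mat_delete_def det_single)
  show ?thesis
    using A
    by (simp add: laplace_expansion_row[OF A, of 0] cofactor_def numeral_3_eq_3 mat_delete_def
        det2 numeral_2_eq_2 algebra_simps)
qed

section \<open>The trace of multiplication and its nondegeneracy\<close>

definition trace_form :: "'k :: field_char_0 list \<Rightarrow> 'k \<Rightarrow> rat" where
  "trace_form bs x = (\<Sum>i<length bs. coord bs (x * bs ! i) i)"

lemma trace_form_add:
  "is_rat_basis bs \<Longrightarrow> trace_form bs (x + y) = trace_form bs x + trace_form bs y"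
  by (simp add: trace_form_def coord_add sum.distrib distrib_right)

lemma trace_form_of_rat_mult:
  "is_rat_basis bs \<Longrightarrow> trace_form bs (of_rat q * x) = q * trace_form bs x"
  by (simp add: trace_form_def coord_of_rat_mult sum_distrib_left mult.assoc)

lemma trace_form_sum:
  assumes "is_rat_basis bs"
  shows "trace_form bs (\<Sum>i\<in>I. of_rat (q i) * f i) = (\<Sum>i\<in>I. q i * trace_form bs (f i))"
proof -
  have "trace_form bs 0 = 0" using assms by (simp add: trace_form_def coord_zero)
  then show ?thesis
    by (induction I rule: infinite_finite_induct)
      (auto simp: trace_form_add trace_form_of_rat_mult assms)
qed

lemma trace_form_one: "is_rat_basis bs \<Longrightarrow> trace_form bs 1 = of_nat (length bs)"
  by (simp add: trace_form_def coord_basis)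

text \<open>If x were nonzero, expanding its inverse in the basis would write 1 as a combination of
  the x b_j. Its trace would vanish, yet the trace of 1 is the dimension.\<close>

lemma trace_form_nondegenerate:
  assumes bs: "is_rat_basis bs" and ne: "bs \<noteq> []"
    and 0: "\<And>j. j < length bs \<Longrightarrow> trace_form bs (x * bs ! j) = 0"
  shows "x = 0"
proof (rule ccontr)
  assume "x \<noteq> 0"
  then have "1 = x * (\<Sum>j<length bs. of_rat (coord bs (inverse x) j) * bs ! j)"
    by (simp add: coord_expand[OF bs])
  also have "\<dots> = (\<Sum>j<length bs. of_rat (coord bs (inverse x) j) * (x * bs ! j))"
    by (simp add: sum_distrib_left mult.left_commute)
  finally have "trace_form bs 1 = (\<Sum>j<length bs. coord bs (inverse x) j * trace_form bs (x * bs ! j))"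
    using trace_form_sum[OF bs] by metis
  then show False using ne by (simp add: 0 trace_form_one[OF bs])
qed

lemma mult_matrix_add_of_int:
  assumes bs: "is_rat_basis bs" and "i < length bs" "j < length bs"
  shows "mult_matrix bs (of_int m + x) $$ (i, j)
       = (if i = j then of_int m else 0) + mult_matrix bs x $$ (i, j)"
  using assms by (simp add: mult_matrix_index distrib_right coord_add coord_of_int_mult coord_basis)

text \<open>With M the matrix of x, det (M + c I) = c^3 + c^2 tr M + c e + det M for some e. Adding
  the values at c = 1 and c = -1 cancels the odd terms.\<close>

lemma det_mult_matrix_second_difference:
  assumes bs: "is_rat_basis bs" and len: "length bs = 3"
  shows "det (mult_matrix bs (x + 1)) + det (mult_matrix bs (x - 1)) - 2 * det (mult_matrix bs x)
       = 2 * trace_form bs x"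
proof -
  have 3: "{..<3} = {0, 1, 2 :: nat}" by auto
  have carr: "mult_matrix bs y \<in> carrier_mat 3 3" for y
    using mult_matrix_carrier[of bs y] len by simp
  have tr: "trace_form bs x = mult_matrix bs x $$ (0, 0) + mult_matrix bs x $$ (1, 1) + mult_matrix bs x $$ (2, 2)"
    by (simp add: trace_form_def len 3 mult_matrix_index)
  have shift: "x + 1 = of_int 1 + x" "x - 1 = of_int (- 1) + x" by simp_all
  show ?thesis
    unfolding tr shift det_3[OF carr]
    by (simp add: mult_matrix_add_of_int[OF bs] len del: of_int_1 of_int_minus)
      (simp add: algebra_simps)
qed

lemma trace_form_in_Ints:
  assumes bs: "is_rat_basis bs" and "length bs = 3" and x: "algebraic_int x"
  shows "2 * trace_form bs x \<in> \<int>"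
proof -
  have one: "algebraic_int (1 :: 'a)" using algebraic_int_of_int[of 1] by simp
  show ?thesis
    unfolding det_mult_matrix_second_difference[OF assms(1,2), symmetric]
    using x one
    by (intro Ints_add Ints_diff Ints_mult det_mult_matrix_in_Ints[OF bs] algebraic_int_add algebraic_int_diff) auto
qed

section \<open>Bases consisting of algebraic integers\<close>

lemma algebraic_int_multiple:
  fixes y :: "'k :: field_char_0" and bs :: "'k list"
  assumes bs: "is_rat_basis bs" and ne: "bs \<noteq> []"
  obtains m :: int where "m > 0" "algebraic_int (of_int m * y)"
proof -
  define N where "N = length bs"
  obtain m :: int where m: "m > 0"
    "\<And>i j. i < N \<Longrightarrow> j < N \<Longrightarrow> of_int m * coord bs (y * bs ! i) j \<in> \<int>"
    using common_denominator[of "{..<N} \<times> {..<N}" "\<lambda>(i, j). coord bs (y * bs ! i) j"] by auto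
  define A where "A i j = \<lfloor>of_int m * coord bs (y * bs ! i) j\<rfloor>" for i j
  have A: "of_int (A i j) = of_int m * coord bs (y * bs ! i) j" if "i < N" "j < N" for i j
    using m(2)[OF that] by (auto simp: A_def elim: Ints_cases)
  \<comment> \<open>After clearing denominators, the basis vectors form an eigenvector of the
    integer matrix \<open>A\<close> with eigenvalue m y.\<close>
  have "of_int m * y * bs ! i = (\<Sum>j<N. of_int (A i j) * bs ! j)" if "i < N" for i
  proof -
    have "of_int m * y * bs ! i = of_int m * (\<Sum>j<N. of_rat (coord bs (y * bs ! i) j) * bs ! j)"
      by (simp add: N_def coord_expand[OF bs] mult.assoc)
    also have "\<dots> = (\<Sum>j<N. of_rat (of_int m * coord bs (y * bs ! i) j) * bs ! j)"
      by (simp add: sum_distrib_left of_rat_mult mult.assoc)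
    also have "\<dots> = (\<Sum>j<N. of_int (A i j) * bs ! j)"
      by (rule sum.cong) (auto simp: that simp flip: A)
    finally show ?thesis .
  qed
  moreover have "0 < N" "bs ! 0 \<noteq> 0"
    using coord_basis[OF bs, of 0 0] coord_zero[OF bs, of 0] ne by (auto simp: N_def)
  ultimately have "algebraic_int (of_int m * y)"
    by (intro algebraic_int_if_int_matrix[of N _ "(!) bs" A 0])
  with m(1) show ?thesis by (rule that)
qed

lemma integral_rat_basis:
  fixes bs :: "'k :: field_char_0 list"
  assumes bs: "is_rat_basis bs"
  obtains cs :: "'k list" where "is_rat_basis cs" "\<And>c. c \<in> set cs \<Longrightarrow> algebraic_int c"
proof -
  \<comment> \<open>The bound on i stands inside the existential, so that a choice function on all
    naturals can be extracted.\<close>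
  have "\<exists>m :: int. i < length bs \<longrightarrow> m > 0 \<and> algebraic_int (of_int m * bs ! i)" for i
    using algebraic_int_multiple[OF bs, where y = "bs ! i"]
    by (metis length_greater_0_conv less_zeroE neq0_conv)
  then obtain m :: "nat \<Rightarrow> int"
    where m: "\<And>i. i < length bs \<Longrightarrow> m i > 0 \<and> algebraic_int (of_int (m i) * bs ! i)"
    by metis
  define cs where "cs = map (\<lambda>i. of_int (m i) * bs ! i) [0..<length bs]"
  have len: "length cs = length bs" by (simp add: cs_def)
  have "is_rat_basis cs"
  proof (rule is_rat_basis_if_independent[OF bs len])
    fix q i assume 0: "(\<Sum>i<length cs. of_rat (q i) * cs ! i) = 0" and i: "i < length cs"
    have "(\<Sum>i<length bs. of_rat (q i * of_int (m i)) * bs ! i) = 0"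
      using 0 by (simp add: cs_def of_rat_mult mult.assoc)
    then have "q i * of_int (m i) = 0"
      using coord_unique[OF bs, of i "\<lambda>i. q i * of_int (m i)"] i len by (simp add: coord_zero[OF bs])
    then show "q i = 0" using m[of i] i len by simp
  qed
  moreover have "algebraic_int c" if "c \<in> set cs" for c
    using that m by (auto simp: cs_def)
  ultimately show ?thesis by (rule that)
qed

text \<open>The factor \<open>2\<close> is there because only twice the trace is obtained as an integer combination
  of norms.\<close>

definition trace_matrix :: "'k :: field_char_0 list \<Rightarrow> 'k list \<Rightarrow> rat mat" where
  "trace_matrix cs xs = mat 3 3 (\<lambda>(i, j). 2 * trace_form cs (xs ! i * cs ! j))"

lemma trace_matrix_carrier: "trace_matrix cs xs \<in> carrier_mat 3 3"
  by (simp add: trace_matrix_def)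

section \<open>Trace determinants of integral triples\<close>

lemma det_trace_matrix_in_Ints:
  assumes "is_rat_basis cs" "length cs = 3" "length xs = 3"
    and "\<And>c. c \<in> set cs \<Longrightarrow> algebraic_int c" "\<And>x. x \<in> set xs \<Longrightarrow> algebraic_int x"
  shows "det (trace_matrix cs xs) \<in> \<int>"
  using assms
  by (intro det_in_Ints[OF trace_matrix_carrier])
    (auto simp: trace_matrix_def intro!: trace_form_in_Ints algebraic_int_mult)

text \<open>A kernel vector v yields x = \<Sum> v_j c_j whose products with all basis vectors have
  trace 0. Nondegeneracy gives x = 0, hence v = 0.\<close>

lemma det_trace_matrix_basis:
  assumes cs: "is_rat_basis cs" and len: "length cs = 3"
  shows "det (trace_matrix cs cs) \<noteq> 0"
proof
  assume "det (trace_matrix cs cs) = 0"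
  then obtain v where v: "v \<in> carrier_vec 3" "v \<noteq> 0\<^sub>v 3" "trace_matrix cs cs *\<^sub>v v = 0\<^sub>v 3"
    using det_0_iff_vec_prod_zero_field[OF trace_matrix_carrier] by blast
  define x where "x = (\<Sum>j<3. of_rat (v $ j) * cs ! j)"
  have "trace_form cs (x * cs ! i) = 0" if i: "i < length cs" for i
  proof -
    have "x * cs ! i = (\<Sum>j<3. of_rat (v $ j) * (cs ! i * cs ! j))"
      unfolding x_def sum_distrib_right by (rule sum.cong) (auto simp: mult_ac)
    then have "2 * trace_form cs (x * cs ! i) = 2 * (\<Sum>j<3. v $ j * trace_form cs (cs ! i * cs ! j))"
      by (simp add: trace_form_sum[OF cs])
    also have "\<dots> = (trace_matrix cs cs *\<^sub>v v) $ i"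
      using i len v(1)
      by (simp add: trace_matrix_def scalar_prod_def atLeast0LessThan sum_distrib_left mult_ac)
    also have "\<dots> = 0" using v(3) i len by simp
    finally show ?thesis by simp
  qed
  then have "x = 0"
    using trace_form_nondegenerate[OF cs] len by fastforce
  then have "v $ i = 0" if "i < 3" for i
    using coord_unique[OF cs, of i "\<lambda>i. v $ i"] len that by (simp add: x_def coord_zero[OF cs])
  then show False using v(1,2) by (auto simp: vec_eq_iff)
qed

text \<open>Multiplying a linear relation among \<open>xs\<close> by each \<open>cs ! j\<close> and
  taking traces makes its coefficients a relation among the rows, that is, a kernel vector of the
  transpose.\<close>

lemma det_trace_matrix_imp_basis:
  assumes cs: "is_rat_basis cs" and len: "length cs = 3" "length xs = 3"
    and nz: "det (trace_matrix cs xs) \<noteq> 0"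
  shows "is_rat_basis xs"
proof (rule is_rat_basis_if_independent[OF cs])
  fix q i assume 0: "(\<Sum>i<length xs. of_rat (q i) * xs ! i) = 0" and i: "i < length xs"
  let ?T = "transpose_mat (trace_matrix cs xs)"
  have T: "?T \<in> carrier_mat 3 3" using trace_matrix_carrier by auto
  have "?T *\<^sub>v vec 3 q = 0\<^sub>v 3"
  proof (rule eq_vecI)
    fix j assume "j < dim_vec (0\<^sub>v 3 :: rat vec)"
    then have j: "j < 3" by simp
    have "(?T *\<^sub>v vec 3 q) $ j = 2 * (\<Sum>i<3. q i * trace_form cs (xs ! i * cs ! j))"
      using j by (simp add: trace_matrix_def scalar_prod_def atLeast0LessThan sum_distrib_left mult_ac)
    also have "\<dots> = 2 * trace_form cs ((\<Sum>i<3. of_rat (q i) * xs ! i) * cs ! j)"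
      unfolding trace_form_sum[OF cs, symmetric] by (simp add: sum_distrib_right mult.assoc)
    also have "\<dots> = 0"
      using 0 len trace_form_of_rat_mult[OF cs, of 0 1] by simp
    finally show "(?T *\<^sub>v vec 3 q) $ j = 0\<^sub>v 3 $ j" using j by simp
  qed (simp add: trace_matrix_def)
  moreover have "det ?T \<noteq> 0" using nz by (simp add: det_transpose[OF trace_matrix_carrier])
  ultimately have "vec 3 q = 0\<^sub>v 3"
    using det_0_iff_vec_prod_zero_field[OF T] by (metis vec_carrier)
  then have "vec 3 q $ i = 0" using i len by simp
  then show "q i = 0" using i len by simp
qed (use len in simp)

text \<open>Row i depends linearly on \<open>xs ! i\<close>. In the replaced row the terms with k
  \<noteq> i repeat another row and contribute nothing, leaving the factor
  \<open>q i\<close>.\<close>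

lemma det_trace_matrix_update:
  assumes cs: "is_rat_basis cs" and len: "length xs = 3" and i: "i < 3"
  shows "det (trace_matrix cs (xs[i := (\<Sum>k<3. of_rat (q k) * xs ! k)])) = q i * det (trace_matrix cs xs)"
proof -
  have 3: "{..<3} = {0, 1, 2 :: nat}" by auto
  define y where "y = (\<Sum>k<3. of_rat (q k) * xs ! k)"
  have y: "trace_form cs (y * c) = q 0 * trace_form cs (xs ! 0 * c) + q 1 * trace_form cs (xs ! 1 * c)
      + q 2 * trace_form cs (xs ! 2 * c)" for c
    by (simp add: y_def 3 distrib_right trace_form_add trace_form_of_rat_mult cs mult.assoc)
  have "i = 0 \<or> i = 1 \<or> i = 2" using i by auto
  then show ?thesis
    unfolding y_def[symmetric] det_3[OF trace_matrix_carrier]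
    by (elim disjE) (simp_all add: trace_matrix_def len y, simp_all add: algebra_simps)
qed

text \<open>Among the integral triples with nonzero trace determinant, one of minimal absolute value
  generates all algebraic integers: otherwise replacing one of its members by the fractional part
  of a non-integral coordinate would make the determinant smaller.\<close>

lemma cubic_integral_basis:
  assumes K: "cubic_field TYPE('k :: field_char_0)"
  obtains xs :: "'k :: field_char_0 list"
  where "is_rat_basis xs" "length xs = 3"
    "\<And>x. algebraic_int x \<longleftrightarrow> (\<forall>i<3. coord xs x i \<in> \<int>)"
proof -
  obtain bs :: "'k list" where "is_rat_basis bs" using cubic_field_basis[OF K] .
  then obtain cs :: "'k list" where cs: "is_rat_basis cs" "\<And>c. c \<in> set cs \<Longrightarrow> algebraic_int c"
    by (rule integral_rat_basis) blast
  have lcs: "length cs = 3"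
    using is_rat_basis_length[OF cs(1)] K by (simp add: cubic_field_def)
  define good where "good xs \<longleftrightarrow> length xs = 3 \<and> (\<forall>x\<in>set xs. algebraic_int x) \<and> det (trace_matrix cs xs) \<noteq> 0" for xs
  \<comment> \<open>A natural number, so that a minimum exists; on integral triples the determinant
    is an integer and the floor loses nothing.\<close>
  define size where "size xs = nat \<lfloor>\<bar>det (trace_matrix cs xs)\<bar>\<rfloor>" for xs
  have "good cs" using cs lcs det_trace_matrix_basis by (simp add: good_def)
  then obtain xs where xs: "good xs" and min: "\<And>ys. good ys \<Longrightarrow> size xs \<le> size ys"
    using ex_has_least_nat[of good cs size] by auto
  have len: "length xs = 3" and int: "\<And>x. x \<in> set xs \<Longrightarrow> algebraic_int x"
    and nz: "det (trace_matrix cs xs) \<noteq> 0" using xs by (auto simp: good_def)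
  have basis: "is_rat_basis xs"
    using det_trace_matrix_imp_basis[OF cs(1) lcs len nz] .
  have size: "of_nat (size ys) = \<bar>det (trace_matrix cs ys)\<bar>"
    if "length ys = 3" "\<And>y. y \<in> set ys \<Longrightarrow> algebraic_int y" for ys
    using det_trace_matrix_in_Ints[OF cs(1) lcs that(1) cs(2) that(2)]
    by (auto simp: size_def elim!: Ints_cases)
  have coord_int: "coord xs x i \<in> \<int>" if x: "algebraic_int x" and i: "i < 3" for x i
  proof (rule ccontr)
    assume nint: "coord xs x i \<notin> \<int>"
    \<comment> \<open>These are the coordinates of \<open>y\<close>: those of \<open>x\<close>, with
      the i-th replaced by its fractional part.\<close>
    define q where "q k = coord xs x k - (if k = i then of_int \<lfloor>coord xs x i\<rfloor> else 0)" for k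
    define y where "y = x - of_int \<lfloor>coord xs x i\<rfloor> * xs ! i"
    have "(\<Sum>k<3. of_rat (q k) * xs ! k)
        = (\<Sum>k<3. of_rat (coord xs x k) * xs ! k) - (\<Sum>k<3. if k = i then of_int \<lfloor>coord xs x i\<rfloor> * xs ! k else 0)"
      unfolding sum_subtractf[symmetric] by (rule sum.cong) (auto simp: q_def of_rat_diff algebra_simps)
    also have "\<dots> = y"
      using coord_expand[OF basis, of x] i by (simp add: len y_def)
    finally have y: "(\<Sum>k<3. of_rat (q k) * xs ! k) = y" .
    have det: "det (trace_matrix cs (xs[i := y])) = q i * det (trace_matrix cs xs)"
      using det_trace_matrix_update[OF cs(1) len i, of q] by (simp add: y)
    have q: "0 < q i" "q i < 1"
      using nint by (auto simp: q_def frac_def[symmetric] frac_lt_1 frac_gt_0_iff)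
    have "algebraic_int y"
      unfolding y_def using x int[of "xs ! i"] i len
      by (intro algebraic_int_diff algebraic_int_mult algebraic_int_of_int) auto
    then have ints: "algebraic_int z" if "z \<in> set (xs[i := y])" for z
      using that int set_update_subset_insert[of xs i y] by auto
    then have "good (xs[i := y])" using q nz by (auto simp: good_def det len)
    \<comment> \<open>Minimality meets a determinant shrunk by the factor \<open>q i\<close> < 1, a
      contradiction.\<close>
    from min[OF this] have "(of_nat (size xs) :: rat) \<le> of_nat (size (xs[i := y]))" by simp
    then have "\<bar>det (trace_matrix cs xs)\<bar> \<le> q i * \<bar>det (trace_matrix cs xs)\<bar>"
      using size[OF len int] size[of "xs[i := y]"] ints q by (simp add: len det abs_mult)
    then show False using q nz by simp
  qed
  have "algebraic_int x" if "\<forall>i<3. coord xs x i \<in> \<int>" for x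
  proof -
    have "algebraic_int (of_rat (coord xs x i) * xs ! i)" if "i < 3" for i
      using \<open>\<forall>i<3. coord xs x i \<in> \<int>\<close> that int[of "xs ! i"] len
      by (intro algebraic_int_mult) (auto elim!: Ints_cases intro: algebraic_int_of_int)
    then have "algebraic_int (\<Sum>i<3. of_rat (coord xs x i) * xs ! i)"
      by (intro algebraic_int_sum) auto
    then show ?thesis using coord_expand[OF basis, of x] by (simp add: len)
  qed
  with coord_int show ?thesis
    by (intro that[OF basis len]) blast
qed

section \<open>Finite fields\<close>

text \<open>Multiplication by a nonzero element is injective, hence surjective on a finite carrier,
  so it reaches 1.\<close>

lemma (in domain) finite_domain_is_field:
  assumes "finite (carrier R)"
  shows "field R"
proof (rule cring_fieldI2)
  show "\<zero> \<noteq> \<one>" by simp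
  fix a assume a: "a \<in> carrier R" "a \<noteq> \<zero>"
  have "inj_on ((\<otimes>) a) (carrier R)"
    using a m_lcancel by (auto intro!: inj_onI)
  then have "(\<otimes>) a ` carrier R = carrier R"
    using assms a by (intro endo_inj_surj) auto
  then show "\<exists>b\<in>carrier R. a \<otimes> b = \<one>"
    by (metis imageE one_closed)
qed

lemma (in field) finite_subring_is_subfield:
  assumes "finite (carrier R)" "subring K R"
  shows "subfield K R"
proof -
  have "finite (carrier (R\<lparr>carrier := K\<rparr>))"
    using finite_subset[OF subringE(1)[OF assms(2)] assms(1)] by simp
  then have "field (R\<lparr>carrier := K\<rparr>)"
    using domain.finite_domain_is_field[OF subring_is_domain[OF assms(2)]] by simp
  then show ?thesis
    using subfield_iff(1)[OF _ subringE(1)[OF assms(2)]] by simp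
qed

text \<open>With respect to a base, the elements of \<open>E\<close> correspond bijectively to their
  coefficient lists of length n over \<open>K\<close>.\<close>

lemma (in field) card_eq_power_dimension:
  assumes K: "subfield K R" and "finite K" and "dimension n K E"
  shows "card E = card K ^ n"
proof -
  obtain Us where Us: "set Us \<subseteq> carrier R" "independent K Us" "length Us = n" "Span K Us = E"
    using exists_base[OF K assms(3)] by blast
  have E: "E = (\<lambda>Ks. combine Ks Us) ` {Ks. set Ks \<subseteq> K \<and> length Ks = n}"
    using Span_eq_combine_set_length_version[OF K Us(1)] Us by auto
  have "inj_on (\<lambda>Ks. combine Ks Us) {Ks. set Ks \<subseteq> K \<and> length Ks = n}"
  proof (rule inj_onI)
    fix Ks Ls assume "Ks \<in> {Ks. set Ks \<subseteq> K \<and> length Ks = n}" "Ls \<in> {Ks. set Ks \<subseteq> K \<and> length Ks = n}"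
      and eq: "combine Ks Us = combine Ls Us"
    moreover from this have "combine Ks Us \<in> Span K Us" using E Us(4) by auto
    from unique_decomposition[OF K Us(2) this]
    have "\<exists>!Js. set Js \<subseteq> K \<and> length Js = n \<and> combine Ks Us = combine Js Us"
      by (simp add: Us(3))
    ultimately show "Ks = Ls" by auto
  qed
  then show ?thesis
    using card_lists_length_eq[OF \<open>finite K\<close>, of n] by (simp add: E card_image)
qed

text \<open>Counting gives degree 3. By the tower law the degree of K(x) divides 3, and it is not 1
  because x lies outside K; so the first three powers of x are independent and span.\<close>

lemma (in field) powers_basis_of_cubic_extension:
  assumes fin: "finite (carrier R)" and K: "subfield K R" and card: "card (carrier R) = card K ^ 3"
    and x: "x \<in> carrier R" "x \<notin> K"
  shows "independent K [\<one>, x, x [^] (2 :: nat)] \<and> Span K [\<one>, x, x [^] (2 :: nat)] = carrier R"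
proof -
  have finK: "finite K" using fin subfieldE(3)[OF K] finite_subset by blast
  have fd: "finite_dimension F (carrier R)" if F: "subfield F R" for F
  proof -
    obtain Us where "set Us = carrier R" using finite_list[OF fin] by blast
    then show ?thesis
      using Span_finite_dimension[OF F, of Us] Span_base_incl[OF F, of Us] Span_subgroup_props(1)[OF F, of Us]
      by (metis subset_antisym subset_refl)
  qed
  obtain n where n: "dimension n K (carrier R)" using fd[OF K] by auto
  have "{\<zero>, \<one>} \<subseteq> K" using subringE(2,3)[OF subfieldE(1)[OF K]] by simp
  \<comment> \<open>A base above 1 allows the exponents n and 3 to be compared.\<close>
  then have "card K \<ge> 2" using card_mono[OF finK, of "{\<zero>, \<one>}"] by simp
  moreover have "card K ^ n = card K ^ 3"
    using card_eq_power_dimension[OF K finK n] card by simp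
  ultimately have n3: "dimension 3 K (carrier R)"
    using n by (simp add: power_inject_exp)
  define L where "L = simple_extension K x"
  have alg: "(algebraic over K) x"
    using finite_dimension_imp_algebraic[OF K carrier_is_subring fd[OF K]] x by simp
  then have L: "subfield L R"
    using simple_extension_is_subfield[OF K] x by (simp add: L_def)
  obtain d where d: "dimension d K L" "independent K (exp_base x d)"
    using dimension_simple_extension[OF K x(1) alg] exp_base_independent[OF K x(1) alg]
    by (auto simp: L_def)
  obtain e where "dimension e L (carrier R)" using fd[OF L] by auto
  then have "d * e = 3"
    using telescopic_base[OF K L d(1)] dimension_is_inj[OF K n3] by metis
  then have "d dvd 3" by (metis dvd_triv_left)
  then have "d = 1 \<or> d = 3"
    using prime_nat_iff[of 3] by auto
  moreover have "d \<noteq> 1"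
  proof
    assume "d = 1"
    have sub: "K \<subseteq> L" "x \<in> L"
      unfolding L_def
      using simple_extension_incl[OF subfieldE(3)[OF K] x(1)] simple_extension_mem[OF subfieldE(1)[OF K] x(1)] by auto
    \<comment> \<open>K is one-dimensional over itself, so a base of K would also span L, giving K =
      L and x in K.\<close>
    obtain u where u: "set u \<subseteq> carrier R" "independent K u" "length u = 1" "Span K u = K"
      using exists_base[OF K dimension_one[OF K]] by blast
    then have "set u \<subseteq> L" using Span_base_incl[OF K u(1)] sub by auto
    then have "Span K u = L"
      using independent_length_eq_dimension[OF K d(1) u(2)] u(3) \<open>d = 1\<close> by simp
    then show False using u(4) sub x by simp
  qed
  ultimately have "independent K (exp_base x 3)" using d by simp
  \<comment> \<open>\<open>exp_base\<close> lists the powers in descending order; independence does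
    not depend on the order.\<close>
  then have "independent K [x [^] (2 :: nat), x, \<one>]"
    using x by (simp add: exp_base_def numeral_3_eq_3 numeral_2_eq_2)
  then have ind: "independent K [\<one>, x, x [^] (2 :: nat)]"
    by (rule independent_same_set[OF K, rotated 2]) auto
  then have "Span K [\<one>, x, x [^] (2 :: nat)] = carrier R"
    using independent_length_eq_dimension[OF K n3 ind] x by auto
  with ind show ?thesis by simp
qed

lemma (in field) powers_dependent:
  assumes K: "subfield K R" and x: "x \<in> K"
  shows "dependent K [\<one>, x, x [^] (2 :: nat)]"
proof
  assume ind: "independent K [\<one>, x, x [^] (2 :: nat)]"
  note props = subringE[OF subfieldE(1)[OF K]]
  have xc: "x \<in> carrier R" using x subfieldE(3)[OF K] by auto
  \<comment> \<open>The relation x 1 - 1 x + 0 x^2 = 0 has coefficients in K. The contradiction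
    comes from the coefficient -1, since x itself may be 0.\<close>
  have "combine [x, \<ominus> \<one>, \<zero>] [\<one>, x, x [^] (2 :: nat)] = \<zero>"
    using xc by (simp add: l_minus r_neg)
  then have "set (take 3 [x, \<ominus> \<one>, \<zero>]) \<subseteq> {\<zero>}"
    using independent_imp_trivial_combine[OF K ind, of "[x, \<ominus> \<one>, \<zero>]"] x props by simp
  then show False
    using minus_minus[of \<one>] by (simp add: numeral_3_eq_3)
qed

section \<open>Reduction modulo a prime\<close>

lemma ring_of_integers_simps [simp]:
  "carrier \<O> = {x :: 'k :: field_char_0. algebraic_int x}"
  "x \<otimes>\<^bsub>\<O>\<^esub> y = x * y" "\<one>\<^bsub>\<O>\<^esub> = (1 :: 'k)" "x \<oplus>\<^bsub>\<O>\<^esub> y = x + y" "\<zero>\<^bsub>\<O>\<^esub> = (0 :: 'k)"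
  by (simp_all add: ring_of_integers_def ring_of_type_algebra_def)

lemma ring_of_integers_domain: "domain (\<O> :: 'k :: field_char_0 ring)"
proof -
  have one: "algebraic_int (1 :: 'k)" using algebraic_int_of_int[of 1] by simp
  have neg: "\<exists>y. algebraic_int y \<and> y + x = 0" if "algebraic_int x" for x :: 'k
    using that by (intro exI[of _ "- x"]) auto
  have "cring (\<O> :: 'k ring)"
    by (intro cringI abelian_groupI comm_monoidI)
      (auto simp: algebra_simps one intro: algebraic_int_add algebraic_int_mult neg)
  then show ?thesis
    by (intro domain.intro domain_axioms.intro) auto
qed

lemma ring_of_integers_nat_pow: "x [^]\<^bsub>\<O>\<^esub> (n :: nat) = x ^ n"
  by (induction n) (auto simp: nat_pow_def mult.commute)

lemma ring_of_integers_minus: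
  assumes "algebraic_int (y :: 'k :: field_char_0)"
  shows "x \<ominus>\<^bsub>\<O>\<^esub> y = x - y"
proof -
  interpret domain "\<O> :: 'k ring" by (rule ring_of_integers_domain)
  have "\<ominus>\<^bsub>\<O>\<^esub> y = - y" using assms by (intro minus_equality) auto
  then show ?thesis by (simp add: a_minus_def)
qed

lemma ring_of_integers_add_pow: "add_pow \<O> (n :: int) (1 :: 'k :: field_char_0) = of_int n"
proof -
  interpret domain "\<O> :: 'k ring" by (rule ring_of_integers_domain)
  have nat: "add_pow \<O> (m :: nat) (1 :: 'k) = of_nat m" for m
    by (induction m) (auto simp: add_pow_def nat_pow_def)
  show ?thesis
  proof (cases "n \<ge> 0")
    case True
    then show ?thesis by (simp add: add_pow_int_ge nat)
  next
    case False
    have "\<ominus>\<^bsub>\<O>\<^esub> (of_nat (nat (- n)) :: 'k) = - of_nat (nat (- n))"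
      using algebraic_int_of_int[of "- n", where 'k = 'k] algebraic_int_of_int[of n, where 'k = 'k] False
      by (intro minus_equality) auto
    with False show ?thesis by (simp add: add_pow_int_lt nat)
  qed
qed

text \<open>Turns ideal membership into integrality of a quotient taken in the field, the form in
  which congruences are handled from here on.\<close>

lemma ring_of_integers_PIdl:
  assumes "c \<noteq> (0 :: 'k :: field_char_0)"
  shows "y \<in> PIdl\<^bsub>\<O>\<^esub> c \<longleftrightarrow> algebraic_int (y / c)"
proof -
  have "y \<in> PIdl\<^bsub>\<O>\<^esub> c \<longleftrightarrow> (\<exists>x. y = x * c \<and> algebraic_int x)"
    by (simp add: cgenideal_def)
  also have "\<dots> \<longleftrightarrow> algebraic_int (y / c)"
    using assms by (auto intro!: exI[of _ "y / c"])
  finally show ?thesis .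
qed

lemma ring_of_integers_PIdl_nat_ideal:
  "ideal (PIdl\<^bsub>\<O>\<^esub> (of_nat p :: 'k :: field_char_0)) \<O>"
proof -
  interpret domain "\<O> :: 'k ring" by (rule ring_of_integers_domain)
  show ?thesis
    using algebraic_int_of_int[of "int p", where 'k = 'k] by (intro cgenideal_ideal) simp
qed

section \<open>The reduction homomorphism and the prime subring\<close>

lemma reduce_mod_hom:
  "ring_hom_ring (\<O> :: 'k :: field_char_0 ring) (residue_ring_at TYPE('k) p) (reduce_mod p)"
proof -
  have "(reduce_mod p :: 'k \<Rightarrow> 'k set) = (+>\<^bsub>\<O>\<^esub>) (PIdl\<^bsub>\<O>\<^esub> (of_nat p))"
    by (rule ext) (simp add: reduce_mod_def)
  then show ?thesis
    using ideal.rcos_ring_hom_ring[OF ring_of_integers_PIdl_nat_ideal[of p, where 'k = 'k]]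
    by (simp add: residue_ring_at_def)
qed

lemma residue_ring_carrier:
  "carrier (residue_ring_at TYPE('k :: field_char_0) p) = reduce_mod p ` {x :: 'k. algebraic_int x}"
  by (auto simp: residue_ring_at_def FactRing_def A_RCOSETS_def' reduce_mod_def)

lemma reduce_mod_eq_iff:
  fixes x y :: "'k :: field_char_0"
  assumes "p > 0" "algebraic_int x" "algebraic_int y"
  shows "reduce_mod p x = reduce_mod p y \<longleftrightarrow> algebraic_int ((x - y) / of_nat p)"
proof -
  interpret domain "\<O> :: 'k ring" by (rule ring_of_integers_domain)
  show ?thesis
    using quotient_eq_iff_same_a_r_cos[OF ring_of_integers_PIdl_nat_ideal[of p, where 'k = 'k], of x y] assms
    by (simp add: reduce_mod_def ring_of_integers_minus ring_of_integers_PIdl)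
qed

lemma residue_ring_zero:
  "\<zero>\<^bsub>residue_ring_at TYPE('k :: field_char_0) p\<^esub> = reduce_mod p (0 :: 'k)"
proof -
  interpret h: ring_hom_ring "\<O> :: 'k ring" "residue_ring_at TYPE('k) p" "reduce_mod p"
    by (rule reduce_mod_hom)
  show ?thesis using h.hom_zero by simp
qed

lemma residue_ring_one:
  "\<one>\<^bsub>residue_ring_at TYPE('k :: field_char_0) p\<^esub> = reduce_mod p (1 :: 'k)"
proof -
  interpret h: ring_hom_ring "\<O> :: 'k ring" "residue_ring_at TYPE('k) p" "reduce_mod p"
    by (rule reduce_mod_hom)
  show ?thesis using h.hom_one by simp
qed

lemma residue_ring_prime_subring:
  "prime_subring (residue_ring_at TYPE('k :: field_char_0) p) = reduce_mod p ` range (of_int :: int \<Rightarrow> 'k)"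
proof -
  interpret h: ring_hom_ring "\<O> :: 'k ring" "residue_ring_at TYPE('k) p" "reduce_mod p"
    by (rule reduce_mod_hom)
  have one: "algebraic_int (1 :: 'k)" using algebraic_int_of_int[of 1] by simp
  have "add_pow (residue_ring_at TYPE('k) p) n \<one>\<^bsub>residue_ring_at TYPE('k) p\<^esub> = reduce_mod p (of_int n)" for n :: int
    using group_hom.hom_int_pow[OF h.a_group_hom, of 1 n] one
    by (simp add: residue_ring_one ring_of_integers_add_pow[symmetric] add_pow_def)
  then show ?thesis by (auto simp: prime_subring_def image_image)
qed

section \<open>Sizes of the residue ring and of its prime subring\<close>

lemma algebraic_int_of_int_divide:
  assumes "p > 0" "algebraic_int (of_int n / of_nat p :: 'k :: field_char_0)"
  shows "int p dvd n"
proof -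
  \<comment> \<open>A rational algebraic integer is an integer, so congruences between integers mean
    the same in \<int> and in the ring of integers.\<close>
  have "(of_int n / of_nat p :: 'k) \<in> \<rat>" by (intro Rats_divide) auto
  then have "(of_int n / of_nat p :: 'k) \<in> \<int>"
    using assms rational_algebraic_int_is_int by blast
  then obtain m where "(of_int n / of_nat p :: 'k) = of_int m" by (auto elim: Ints_cases)
  then have "(of_int n :: 'k) = of_int (int p * m)" using assms(1) by (simp add: field_simps)
  then have "n = int p * m" by (simp only: of_int_eq_iff)
  then show ?thesis by simp
qed

lemma card_prime_subring:
  assumes "p > 0"
  shows "card (prime_subring (residue_ring_at TYPE('k :: field_char_0) p)) = p"
proof -
  let ?f = "\<lambda>n :: nat. reduce_mod p (of_int (int n) :: 'k)"
  have eq: "reduce_mod p (of_int m :: 'k) = reduce_mod p (of_int n) \<longleftrightarrow> int p dvd m - n" for m n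
  proof -
    have "reduce_mod p (of_int m :: 'k) = reduce_mod p (of_int n) \<longleftrightarrow>
        algebraic_int (of_int (m - n) / of_nat p :: 'k)"
      using reduce_mod_eq_iff[OF assms, of "of_int m :: 'k" "of_int n"]
      by (simp add: algebraic_int_of_int)
    also have "\<dots> \<longleftrightarrow> int p dvd m - n"
    proof
      assume "int p dvd m - n"
      then obtain k where "m - n = int p * k" by auto
      then have "(of_int (m - n) / of_nat p :: 'k) = of_int k" using assms by (simp del: of_int_diff)
      then show "algebraic_int (of_int (m - n) / of_nat p :: 'k)" by (simp only: algebraic_int_of_int)
    qed (use algebraic_int_of_int_divide assms in blast)
    finally show ?thesis .
  qed
  have "inj_on ?f {..<p}"
  proof (rule inj_onI)
    fix m n assume mn: "m \<in> {..<p}" "n \<in> {..<p}" "?f m = ?f n"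
    then have "int m mod int p = int n mod int p"
      using eq[of "int m" "int n"] by (simp only: mod_eq_dvd_iff)
    with mn show "m = n" by simp
  qed
  moreover have "?f ` {..<p} = reduce_mod p ` range (of_int :: int \<Rightarrow> 'k)"
  proof safe
    fix n :: int
    have "reduce_mod p (of_int n :: 'k) = ?f (nat (n mod int p))"
      using assms eq by (simp add: mod_eq_dvd_iff[symmetric])
    moreover have "nat (n mod int p) < p" using assms by (simp add: nat_less_iff)
    ultimately show "reduce_mod p (of_int n :: 'k) \<in> ?f ` {..<p}" by blast
  qed (intro imageI rangeI)
  ultimately show ?thesis
    using card_image[of ?f "{..<p}"] by (simp add: residue_ring_prime_subring)
qed

text \<open>An integral basis identifies the ring of integers with \<int>^3 and its multiples of p
  with p \<int>^3. Triples of coordinates below p therefore represent each class exactly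
  once.\<close>

lemma card_residue_ring:
  assumes K: "cubic_field TYPE('k :: field_char_0)" and p: "p > 0"
  shows "card (carrier (residue_ring_at TYPE('k :: field_char_0) p)) = p ^ 3"
proof -
  obtain xs :: "'k list" where xs: "is_rat_basis xs" and len: "length xs = 3"
    and int: "\<And>x. algebraic_int x \<longleftrightarrow> (\<forall>i<3. coord xs x i \<in> \<int>)"
    using cubic_integral_basis[OF K] by metis
  define f where "f g = (\<Sum>i<3. of_rat (of_nat (g i)) * xs ! i)" for g :: "nat \<Rightarrow> nat"
  have f: "coord xs (f g) i = of_nat (g i)" if "i < 3" for g i
    using coord_unique[OF xs, of i "\<lambda>i. of_nat (g i)"] that len by (simp add: f_def)
  have fint: "algebraic_int (f g)" for g by (simp add: int f)
  have eq: "reduce_mod p x = reduce_mod p y \<longleftrightarrow> (\<forall>i<3. (coord xs x i - coord xs y i) / of_nat p \<in> \<int>)"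
    if "algebraic_int x" "algebraic_int y" for x y
  proof -
    have "(x - y) / of_nat p = of_rat (1 / of_nat p) * (x + of_int (- 1) * y)"
      by (simp add: of_rat_divide)
    then have "coord xs ((x - y) / of_nat p) i = (coord xs x i - coord xs y i) / of_nat p" for i
      by (simp only: coord_of_rat_mult[OF xs] coord_add[OF xs] coord_of_int_mult[OF xs]) simp
    then show ?thesis using reduce_mod_eq_iff[OF p that] int by simp
  qed
  \<comment> \<open>Extensional functions are determined by their values below 3, so there are
    exactly p^3 of them.\<close>
  let ?A = "{..<3} \<rightarrow>\<^sub>E {..<p}"
  have "inj_on (\<lambda>g. reduce_mod p (f g)) ?A"
  proof (rule inj_onI)
    fix g h assume gh: "g \<in> ?A" "h \<in> ?A" and "reduce_mod p (f g) = reduce_mod p (f h)"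
    then have dv: "(of_nat (g i) - of_nat (h i) :: rat) / of_nat p \<in> \<int>" if "i < 3" for i
      using that eq[OF fint fint] by (simp add: f)
    show "g = h"
    proof (rule PiE_ext[OF gh])
      fix i assume "i \<in> {..<3 :: nat}"
      then have i: "i < 3" by simp
      obtain m where "(of_nat (g i) - of_nat (h i) :: rat) / of_nat p = of_int m"
        using dv[OF i] by (auto elim: Ints_cases)
      then have "(of_int (int (g i) - int (h i)) :: rat) = of_int (int p * m)"
        using p by (simp add: field_simps)
      then have "int (g i) - int (h i) = int p * m" by (simp only: of_int_eq_iff)
      then have "int p dvd int (g i) - int (h i)" by simp
      then have "int (g i) mod int p = int (h i) mod int p" by (simp add: mod_eq_dvd_iff)
      moreover have "g i < p" "h i < p" using gh i by auto
      ultimately show "g i = h i" by simp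
    qed
  qed
  moreover have "(\<lambda>g. reduce_mod p (f g)) ` ?A = reduce_mod p ` {x :: 'k. algebraic_int x}"
  proof safe
    fix x :: 'k assume x: "algebraic_int x"
    define g where "g = (\<lambda>i\<in>{..<3 :: nat}. nat (\<lfloor>coord xs x i\<rfloor> mod int p))"
    have "g \<in> ?A" using p by (auto simp: g_def nat_less_iff)
    moreover have "reduce_mod p x = reduce_mod p (f g)"
    proof (subst eq[OF x fint], intro allI impI)
      fix i :: nat assume i: "i < 3"
      have "coord xs x i \<in> \<int>" using int x i by blast
      then obtain m where m: "coord xs x i = of_int m" by (auto elim: Ints_cases)
      have "of_nat (g i) = (of_int (m mod int p) :: rat)"
        using p i m by (simp add: g_def)
      then have "coord xs x i - coord xs (f g) i = (of_int (m - m mod int p) :: rat)"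
        using i by (simp add: m f)
      also have "m - m mod int p = int p * (m div int p)"
        by (simp add: minus_mod_eq_mult_div)
      finally have "(coord xs x i - coord xs (f g) i) / of_nat p = of_int (m div int p)"
        using p by simp
      then show "(coord xs x i - coord xs (f g) i) / of_nat p \<in> \<int>" by simp
    qed
    ultimately show "reduce_mod p x \<in> (\<lambda>g. reduce_mod p (f g)) ` ?A" by blast
  qed (use fint in auto)
  ultimately show ?thesis
    using card_image[of "\<lambda>g. reduce_mod p (f g)" ?A]
    by (simp add: residue_ring_carrier card_PiE)
qed

text \<open>In an integral basis, multiplication by \<open>1 + p a + p\<^sup>2 \<beta>\<close> has a matrix congruent to
  \<open>(1 + p a) I\<close> modulo \<open>p\<^sup>2\<close>, so its norm is \<open>1 + 3 p a\<close> modulo \<open>p\<^sup>2\<close>.\<close>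

lemma norm_one_imp_dvd:
  fixes \<beta> :: "'k :: field_char_0" and a :: int
  assumes K: "cubic_field TYPE('k :: field_char_0)" and p: "prime p" "p \<ge> 5"
    and \<beta>: "algebraic_int \<beta>"
    and norm: "field_norm (of_int (1 + int p * a) + of_int (int p ^ 2) * \<beta>) = 1"
  shows "int p dvd a"
proof -
  obtain xs :: "'k list" where xs: "is_rat_basis xs" and len: "length xs = 3"
    and int: "\<And>x. algebraic_int x \<longleftrightarrow> (\<forall>i<3. coord xs x i \<in> \<int>)"
    using cubic_integral_basis[OF K] by metis
  define t where "t = 1 + int p * a"
  define s where "s = int p ^ 2"
  define M where "M = mult_matrix xs (of_int t + of_int s * \<beta>)"
  have carr: "M \<in> carrier_mat 3 3"
    using mult_matrix_carrier[of xs] len by (simp add: M_def)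
  have basis_int: "algebraic_int (xs ! j)" if "j < 3" for j
    using that by (auto simp: int coord_basis[OF xs] len)
  define B where "B i j = \<lfloor>coord xs (\<beta> * xs ! j) i\<rfloor>" for i j
  have B: "coord xs (\<beta> * xs ! j) i = of_int (B i j)" if "i < 3" "j < 3" for i j
    using algebraic_int_mult[OF \<beta> basis_int[OF that(2)]] that(1)
    by (auto simp: int B_def elim: Ints_cases)
  have M: "M $$ (i, j) = of_int ((if i = j then t else 0) + s * B i j)" if "i < 3" "j < 3" for i j
  proof -
    have "M $$ (i, j) = (if i = j then of_int t else 0) + mult_matrix xs (of_int s * \<beta>) $$ (i, j)"
      unfolding M_def using that len by (intro mult_matrix_add_of_int[OF xs]) auto
    also have "\<dots> = of_int ((if i = j then t else 0) + s * B i j)"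
      using that by (simp add: mult_matrix_index len mult.assoc coord_of_int_mult[OF xs] B)
    finally show ?thesis .
  qed
  have "\<exists>R. t ^ 3 + s * R =
      (t + s * B 0 0) * ((t + s * B 1 1) * (t + s * B 2 2) - s * B 1 2 * (s * B 2 1))
    - s * B 0 1 * (s * B 1 0 * (t + s * B 2 2) - s * B 1 2 * (s * B 2 0))
    + s * B 0 2 * (s * B 1 0 * (s * B 2 1) - (t + s * B 1 1) * (s * B 2 0))"
    (is "\<exists>R. _ = ?D")
  proof -
    have "s dvd ?D - t ^ 3"
    proof -
      have "[t + s * B i i = t] (mod s)" for i by (simp add: cong_def)
      moreover have "[s * u = 0] (mod s)" for u by (simp add: cong_def)
      \<comment> \<open>Modulo s the diagonal entries become t and the others 0, so the determinant
        becomes t^3.\<close>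
      ultimately have "[?D = t * (t * t - 0 * 0) - 0 * (0 * t - 0 * 0) + 0 * (0 * 0 - t * 0)] (mod s)"
        by (intro cong_add cong_diff cong_mult)
      then show ?thesis by (simp add: cong_iff_dvd_diff power3_eq_cube mult.assoc)
    qed
    then obtain R where "?D - t ^ 3 = s * R" by auto
    then show ?thesis by (intro exI[of _ R]) simp
  qed
  then obtain R where R: "t ^ 3 + s * R = ?D" by blast
  have "det M = of_int ?D"
    unfolding det_3[OF carr] by (simp add: M)
  moreover have "det M = 1"
    using norm by (simp add: field_norm_eq[OF xs] M_def t_def s_def)
  ultimately have "(of_int ?D :: rat) = of_int 1" by simp
  then have "?D = 1" by (simp only: of_int_eq_iff)
  then have "t ^ 3 + s * R = 1" using R by simp
  \<comment> \<open>Expanding (1 + p a)^3 with s = p^2, the constant 1 cancels and a factor p comes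
    out; dividing by it leaves 3 a plus a multiple of p.\<close>
  then have "int p * (3 * a + int p * (3 * a ^ 2 + int p * a ^ 3 + R)) = int p * 0"
    by (simp add: t_def s_def power2_eq_square power3_eq_cube algebra_simps)
  then have "3 * a + int p * (3 * a ^ 2 + int p * a ^ 3 + R) = 0"
    using p by simp
  then have "int p dvd 3 * a"
    by (metis add_0_iff dvd_add_left_iff dvd_triv_left dvd_0_right)
  \<comment> \<open>Here \<open>p \<ge> 5\<close> excludes p = 3, so p can be cancelled against
    3.\<close>
  moreover have "\<not> int p dvd 3"
    using p zdvd_imp_le[of "int p" 3] by auto
  ultimately show ?thesis
    using p prime_dvd_mult_iff[of "int p" 3 a] by simp
qed

section \<open>The residue \<open>omega\<close> and its powers\<close>

theorem theoremB1:
  fixes p :: nat and \<eta> :: "'k :: field_char_0"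
  assumes "cubic_field TYPE('k)"
    and "prime p" and "p \<ge> 5"
    and "inert TYPE('k) p" and "unramified TYPE('k) p"
    and "\<eta> \<in> Units \<O>"
    and "field_norm \<eta> = 1"
  shows "let F = residue_ring_at TYPE('k) p;
             Fp = prime_subring F;
             P = unit_order p \<eta>;
             \<omega> = omega p \<eta>
         in field F \<and> card (carrier F) = p ^ 3 \<and> \<omega> \<in> carrier F \<and>
            (\<omega> \<in> Fp \<longleftrightarrow> \<omega> = \<zero>\<^bsub>F\<^esub>) \<and>
            (\<omega> = \<zero>\<^bsub>F\<^esub> \<longleftrightarrow> \<eta> ^ P - 1 \<in> PIdl\<^bsub>\<O>\<^esub> (of_nat p ^ 2)) \<and>
            (\<not> is_basis_over F Fp [\<one>\<^bsub>F\<^esub>, \<omega>, \<omega> [^]\<^bsub>F\<^esub> (2 :: nat)] \<longleftrightarrow>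
               \<eta> ^ P - 1 \<in> PIdl\<^bsub>\<O>\<^esub> (of_nat p ^ 2))"
proof -
  define F where "F = residue_ring_at TYPE('k) p"
  define Fp where "Fp = prime_subring F"
  define P where "P = unit_order p \<eta>"
  define w where "w = (\<eta> ^ P - 1) / of_nat p"
  have p0: "p > 0" using assms(3) by simp
  have one: "algebraic_int (1 :: 'k)" using algebraic_int_of_int[of 1] by simp
  have card: "card (carrier F) = p ^ 3"
    using card_residue_ring[OF assms(1) p0] by (simp add: F_def)
  then have fin: "finite (carrier F)" using p0 card.infinite by fastforce
  \<comment> \<open>Inertness says that p generates a prime ideal, so the quotient is a domain;
    being finite, it is a field.\<close>
  have "domain F"
    using primeideal.quotient_is_domain assms(4) by (simp add: F_def residue_ring_at_def inert_def)
  then have field: "field F" using fin by (rule domain.finite_domain_is_field)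
  interpret F: field F by (rule field)
  interpret h: ring_hom_ring "\<O> :: 'k ring" F "reduce_mod p"
    unfolding F_def by (rule reduce_mod_hom)
  have Fp: "Fp = reduce_mod p ` range (of_int :: int \<Rightarrow> 'k)"
    by (simp add: Fp_def F_def residue_ring_prime_subring)
  have cardFp: "card Fp = p"
    using card_prime_subring[OF p0] by (simp add: Fp_def F_def)

  \<comment> \<open>The order is taken in the unit group of F, so membership there is required
    before the power P can be known to give 1.\<close>
  have "reduce_mod p \<eta> \<in> Units F"
  proof -
    obtain \<theta> where th: "algebraic_int \<theta>" "\<theta> * \<eta> = 1" and eta: "algebraic_int \<eta>"
      using assms(6) by (auto simp: Units_def)
    have "reduce_mod p \<theta> \<otimes>\<^bsub>F\<^esub> reduce_mod p \<eta> = \<one>\<^bsub>F\<^esub>"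
      using h.hom_mult[of \<theta> \<eta>] th eta h.hom_one by simp
    moreover have "reduce_mod p \<theta> \<in> carrier F" "reduce_mod p \<eta> \<in> carrier F"
      using th eta h.hom_closed by auto
    ultimately show ?thesis
      using F.m_comm[of "reduce_mod p \<theta>" "reduce_mod p \<eta>"]
      by (auto simp: Units_def intro!: bexI[of _ "reduce_mod p \<theta>"])
  qed
  then have "reduce_mod p \<eta> [^]\<^bsub>F\<^esub> P = \<one>\<^bsub>F\<^esub>"
    using group.pow_ord_eq_1[OF F.units_group, of "reduce_mod p \<eta>"]
    by (simp add: P_def unit_order_def F_def[symmetric] units_of_carrier units_of_one F.units_of_pow)
  moreover have eta: "algebraic_int \<eta>" using assms(6) by (auto simp: Units_def)
  ultimately have "reduce_mod p (\<eta> ^ P) = reduce_mod p 1"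
    using h.hom_nat_pow[of \<eta> P] h.hom_one by (simp add: ring_of_integers_nat_pow)
  then have w: "algebraic_int w"
    using reduce_mod_eq_iff[OF p0 algebraic_int_power[OF eta] one] by (simp add: w_def)
  have etaP: "\<eta> ^ P = 1 + of_nat p * w" using p0 by (simp add: w_def)
  have omega: "omega p \<eta> = reduce_mod p w" by (simp add: omega_def w_def P_def)
  have mem: "reduce_mod p w \<in> carrier F" using w h.hom_closed by simp

  have zero_iff: "reduce_mod p w = \<zero>\<^bsub>F\<^esub> \<longleftrightarrow> \<eta> ^ P - 1 \<in> PIdl\<^bsub>\<O>\<^esub> (of_nat p ^ 2)"
  proof -
    have "reduce_mod p w = \<zero>\<^bsub>F\<^esub> \<longleftrightarrow> algebraic_int (w / of_nat p)"
      using reduce_mod_eq_iff[OF p0 w algebraic_int_0] by (simp add: F_def residue_ring_zero)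
    also have "w / of_nat p = (\<eta> ^ P - 1) / of_nat p ^ 2"
      by (simp add: w_def power2_eq_square)
    finally show ?thesis using p0 by (simp add: ring_of_integers_PIdl)
  qed

  have Fp_iff: "reduce_mod p w \<in> Fp \<longleftrightarrow> reduce_mod p w = \<zero>\<^bsub>F\<^esub>"
  proof
    assume "reduce_mod p w \<in> Fp"
    then obtain a :: int where a: "reduce_mod p w = reduce_mod p (of_int a)" by (auto simp: Fp)
    \<comment> \<open>The second-order term: \<eta>^P = 1 + p a + p^2 \<beta> with \<beta> integral,
      to which the norm congruence applies.\<close>
    define \<beta> where "\<beta> = (w - of_int a) / of_nat p"
    have \<beta>: "algebraic_int \<beta>"
      unfolding \<beta>_def using reduce_mod_eq_iff[OF p0 w algebraic_int_of_int, of a] a by blast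
    have "w = of_int a + of_nat p * \<beta>" using p0 by (simp add: \<beta>_def)
    then have "\<eta> ^ P = of_int (1 + int p * a) + of_int (int p ^ 2) * \<beta>"
      by (simp add: etaP algebra_simps power2_eq_square)
    moreover obtain bs :: "'k list" where bs: "is_rat_basis bs"
      using cubic_field_basis[OF assms(1)] .
    have "field_norm (\<eta> ^ P) = 1"
      using assms(7) by (simp add: field_norm_eq[OF bs] det_mult_matrix_power[OF bs])
    ultimately have "int p dvd a"
      using norm_one_imp_dvd[OF assms(1-3) \<beta>] by simp
    then obtain b where "a = int p * b" by auto
    then have "algebraic_int ((of_int a - 0) / of_nat p :: 'k)"
      using p0 by (simp add: algebraic_int_of_int)
    then show "reduce_mod p w = \<zero>\<^bsub>F\<^esub>"
      using reduce_mod_eq_iff[OF p0 algebraic_int_of_int algebraic_int_0, of a, where 'k = 'k]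
      by (simp add: a F_def residue_ring_zero)
  next
    assume "reduce_mod p w = \<zero>\<^bsub>F\<^esub>"
    then show "reduce_mod p w \<in> Fp"
      by (auto simp: Fp F_def residue_ring_zero intro!: image_eqI[of _ _ 0] range_eqI[of _ _ 0])
  qed

  \<comment> \<open>Closure is inherited from \<int> through reduction; by finiteness the subring is
    then a subfield, as the dimension argument requires.\<close>
  have "subring Fp F"
  proof (rule F.subringI)
    show "Fp \<subseteq> carrier F" using h.hom_closed by (auto simp: Fp algebraic_int_of_int)
    show "\<one>\<^bsub>F\<^esub> \<in> Fp" using h.hom_one by (auto simp: Fp intro!: image_eqI[of _ _ 1] range_eqI[of _ _ 1])
  next
    fix x assume "x \<in> Fp"
    then obtain a :: int where a: "x = reduce_mod p (of_int a)" by (auto simp: Fp)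
    have "x \<oplus>\<^bsub>F\<^esub> reduce_mod p (of_int (- a)) = \<zero>\<^bsub>F\<^esub>"
      using h.hom_add[of "of_int a" "of_int (- a)"] h.hom_zero algebraic_int_of_int[of a, where 'k = 'k] by (simp add: a)
    then have "\<ominus>\<^bsub>F\<^esub> x = reduce_mod p (of_int (- a))"
      using a h.hom_closed algebraic_int_of_int[of a, where 'k = 'k] algebraic_int_of_int[of "- a", where 'k = 'k]
      by (intro F.sum_zero_eq_neg[symmetric]) (auto simp: F.a_comm)
    then show "\<ominus>\<^bsub>F\<^esub> x \<in> Fp" unfolding Fp by blast
  next
    fix x y assume "x \<in> Fp" "y \<in> Fp"
    then obtain a b :: int where ab: "x = reduce_mod p (of_int a)" "y = reduce_mod p (of_int b)"
      by (auto simp: Fp)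
    have "x \<otimes>\<^bsub>F\<^esub> y = reduce_mod p (of_int (a * b))" "x \<oplus>\<^bsub>F\<^esub> y = reduce_mod p (of_int (a + b))"
      using h.hom_mult[of "of_int a" "of_int b"] h.hom_add[of "of_int a" "of_int b"]
      by (simp_all add: ab algebraic_int_of_int)
    then show "x \<otimes>\<^bsub>F\<^esub> y \<in> Fp" "x \<oplus>\<^bsub>F\<^esub> y \<in> Fp" unfolding Fp by blast+
  qed
  then have sub: "subfield Fp F" by (rule F.finite_subring_is_subfield[OF fin])
  have basis_iff: "is_basis_over F Fp [\<one>\<^bsub>F\<^esub>, reduce_mod p w, reduce_mod p w [^]\<^bsub>F\<^esub> (2 :: nat)]
      \<longleftrightarrow> reduce_mod p w \<notin> Fp"
    \<comment> \<open>Outside \<open>Fp\<close> the degree argument applies, as F has p^3 =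
      \<open>card Fp ^ 3\<close> elements; inside \<open>Fp\<close> the powers are
      dependent.\<close>
    using F.powers_basis_of_cubic_extension[OF fin sub _ mem] F.powers_dependent[OF sub] card cardFp mem
    by (auto simp: is_basis_over_def simp del: F.Span.simps)
  show ?thesis
    using field card mem zero_iff Fp_iff basis_iff
    by (simp add: omega F_def[symmetric] Fp_def[symmetric] P_def[symmetric] Let_def)
qed

end
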